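(* Let $\alpha=\{\alpha_k\}_{k=0}^\infty$ be a sequence of real numbers. The following are equivalent: (i) $V_\alpha(\mathcal{P}^+)\subseteq\mathcal{P}^+\cup\{0\}$; (ii) $V_\alpha(e^z)\in\mathcal{LP}^+\cup\{0\}$, that is, $$\sum_{k=0}^\infty\left(\sum_{j=0}^k\frac{\alpha_j}{(k+1+j)!(k-j)!}\right)z^k\in\mathcal{LP}^+\cup\{0\};$$ (iii) $V_\alpha(\mathcal{LP}^+)\subseteq\mathcal{LP}^+\cup\{0\}$.
   Context: For a polynomial or power series $\phi(z)=\sum_{k\ge0}a_kz^k$, $V_\alpha(\phi)=\sum_{k\ge0}c_kz^k$ with $c_k=\sum_{j\ge0}\alpha_ja_{k-j}a_{k+1+j}$, where $a_j=0$ for $j<0$ (and for $j>n$ if $\phi$ is a polynomial of degree $n$). $\mathcal{P}^+$ is the set of all (nonzero) polynomials with only real and non-positive zeros. The Laguerre–Pólya class $\mathcal{LP}$ is the set of entire functions that are limits, uniformly on compact subsets of $\mathbb{C}$, of real polynomials with only real zeros; $\mathcal{LP}^+$ is the set of functions in $\mathcal{LP}$ with non-negative Taylor coefficients (equivalently, functions $Cz^Me^{az}\prod_j(1+\rho_jz)$ with $a,C\ge0$, $M\in\mathbb{N}$, $\rho_j\ge0$, $\sum_j\rho_j<\infty$).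
   Formalization: P⁺ is restricted to polynomials with positive leading coefficient; without a sign condition the equivalence fails, e.g. for α = (−1,0,0,…), where (i) holds but V_α(e^z) has negative Taylor coefficients, so (ii) fails. *)

theory Defs
  imports "HOL-Complex_Analysis.Complex_Analysis"
begin

text \<open>
  Polynomials and entire functions are identified with their Taylor series at 0. The operator
  is defined on formal power series because, for an arbitrary sequence \<open>\<alpha>\<close>, the image of an entire
  function need not converge anywhere. The terms with \<open>j > k\<close> are absent, as they contain
  a coefficient of negative index.
\<close>

definition V_op :: "(nat \<Rightarrow> real) \<Rightarrow> complex fps \<Rightarrow> complex fps" where
  "V_op \<alpha> \<phi> =
     Abs_fps (\<lambda>k. \<Sum>j\<le>k. of_real (\<alpha> j) * fps_nth \<phi> (k - j) * fps_nth \<phi> (k + 1 + j))"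

text \<open>
  The leading coefficient is normalised to be positive (so the polynomial is real with
  non-negative coefficients). This is the polynomial counterpart of the sign convention in
  \<open>LP_plus\<close> below. Since \<open>V_op \<alpha> (-\<phi>) = V_op \<alpha> \<phi>\<close>, it matters only for the images.
  Without it the two classes do not match: for \<open>\<alpha> = (-1, 0, 0, \<dots>)\<close> the operator sends
  \<open>\<Sum>k. a k z^k\<close> to \<open>- (\<Sum>k. a k a (k+1) z^k)\<close>, which has only real non-positive zeros whenever
  the argument does, but negative coefficients for \<open>exp\<close>.
\<close>

definition P_plus :: "complex poly set" where
  "P_plus = {p. p \<noteq> 0 \<and> lead_coeff p \<in> \<real>\<^sub>\<ge>\<^sub>0 \<and> (\<forall>z. poly p z = 0 \<longrightarrow> z \<in> \<real>\<^sub>\<le>\<^sub>0)}"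

definition real_rooted :: "real poly \<Rightarrow> bool" where
  "real_rooted p \<longleftrightarrow> p \<noteq> 0 \<and> (\<forall>z::complex. poly (map_poly of_real p) z = 0 \<longrightarrow> z \<in> \<real>)"

text \<open>The zero function belongs to both classes below (as the limit of the constants \<open>1/n\<close>).\<close>

definition LP :: "(complex \<Rightarrow> complex) set" where
  "LP = {f. f holomorphic_on UNIV \<and>
     (\<exists>p :: nat \<Rightarrow> real poly. (\<forall>n. real_rooted (p n)) \<and>
        (\<forall>K. compact K \<longrightarrow>
           uniform_limit K (\<lambda>n. poly (map_poly of_real (p n))) f sequentially))}"

abbreviation taylor :: "(complex \<Rightarrow> complex) \<Rightarrow> complex fps" where
  "taylor f \<equiv> fps_expansion f 0"

definition LP_plus :: "(complex \<Rightarrow> complex) set" where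
  "LP_plus = {f \<in> LP. \<forall>n. fps_nth (taylor f) n \<in> \<real>\<^sub>\<ge>\<^sub>0}"

lemma V_op_exp:
  "V_op \<alpha> (fps_exp 1) =
     Abs_fps (\<lambda>k. of_real (\<Sum>j\<le>k. \<alpha> j / (fact (k + 1 + j) * fact (k - j))))"
  by (simp add: V_op_def field_simps)

lemma V_op_uminus: "V_op \<alpha> (- \<phi>) = V_op \<alpha> \<phi>"
  by (simp add: V_op_def)

end

theory Submission
  imports Defs
begin

text \<open>
  Write \<open>\<phi> = \<Prod>(r i + z)\<close>, put \<open>z = w^2\<close> and \<open>\<beta> (2j + 1) = \<alpha> j\<close>, \<open>\<beta> d = 0\<close> for all other integers \<open>d\<close>.
  Then \<open>w * V \<phi> (w^2) = (\<Sum>i j. \<beta> (i - j) a i a j w^(i + j))\<close>, and splitting off one linear factor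
  of \<open>\<phi>\<close> replaces \<open>\<beta>\<close> by \<open>(r^2 + w^2) \<beta> + r w T \<beta>\<close>, where \<open>T \<beta> d = \<beta> (d + 1) + \<beta> (d - 1)\<close>. So
  the sum is \<open>\<Prod>(r i^2 + w^2 + r i w T)\<close> applied to \<open>\<beta>\<close> and evaluated at 0, that is, a symmetric
  multiaffine polynomial in \<open>x i = r i w / (r i^2 + w^2)\<close>, times a nonzero factor. If \<open>Re w > 0\<close> then
  \<open>Re (x i) > 0\<close>, so by the Grace-Walsh-Szego argument (iterated polar derivatives) the sum does not vanish
  as soon as the diagonal polynomial \<open>\<Sum>m. (n choose m) b m y^m\<close>, \<open>b m = (T^m \<beta>) 0\<close>, has no zero
  in the right half-plane. Since \<open>b (2m + 1) / (2m + 1)!\<close> is the \<open>m\<close>-th coefficient of \<open>V exp\<close> and \<open>b (2m) = 0\<close>,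
  this diagonal polynomial is a Jensen polynomial of \<open>y * V exp (y^2)\<close>, and (ii) implies (i).
  For the remaining implications, Jensen polynomials show that \<open>LP_plus\<close> together with 0 consists exactly
  of the coefficientwise limits of polynomials with only non-positive zeros, and \<open>V\<close> is continuous for
  coefficientwise convergence.
\<close>

section \<open>Half-plane stability\<close>

lemma degree_linear_mult: "p \<noteq> 0 \<Longrightarrow> degree ([:-a, 1:] * p) = Suc (degree p)" for p :: "'a :: idom poly"
  by (subst degree_mult_eq) auto


text \<open>The fundamental theorem of algebra splits off one zero at a time, and the quotient keeps
  its zeros in \<open>S\<close>. Arguments about products over zeros become inductions by this
  rule.\<close>

lemma poly_induct_zeros [consumes 2, case_names const factor]:
  fixes p :: "complex poly"
  assumes "p \<noteq> 0" and "\<forall>z. poly p z = 0 \<longrightarrow> z \<in> S"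
    and const: "\<And>c. c \<noteq> 0 \<Longrightarrow> P [:c:]"
    and factor: "\<And>a p. \<lbrakk>a \<in> S; p \<noteq> 0; \<forall>z. poly p z = 0 \<longrightarrow> z \<in> S; P p\<rbrakk> \<Longrightarrow> P ([:-a, 1:] * p)"
  shows "P p"
  using assms(1,2)
proof (induction "degree p" arbitrary: p)
  case 0
  then obtain c where "p = [:c:]" by (metis degree_0_id)
  then show ?case using 0 const by auto
next
  case (Suc n)
  then have "coeff p (degree p) \<noteq> 0" and "degree p \<in> {1..degree p}" by auto
  then obtain a where a: "poly p a = 0"
    unfolding poly_altdef using fundamental_theorem_of_algebra[of "coeff p" "degree p"] by metis
  then obtain q where q: "p = [:-a, 1:] * q" by (metis dvdE poly_eq_0_iff_dvd)
  have "q \<noteq> 0" using q Suc by auto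
  then have "degree p = Suc (degree q)" using q degree_linear_mult by blast
  moreover have "z \<in> S" if "poly q z = 0" for z using Suc.prems(2) that q by simp
  ultimately have "P q" using Suc.hyps \<open>q \<noteq> 0\<close> by simp
  then show ?case using factor[of a q] q a Suc.prems(2) \<open>q \<noteq> 0\<close> by simp
qed

text \<open>\<open>p'/p\<close> is the sum of \<open>1/(y - a)\<close> over the zeros
  \<open>a\<close>. Each summand \<open>u\<close> has
  \<open>Re u = Re (y - a) |u|^2 >= Re y |u|^2\<close>, and Cauchy-Schwarz, in an inductive form
  that adds one summand, yields the factor \<open>degree p\<close>.\<close>

lemma log_deriv_bound:
  fixes p :: "complex poly"
  assumes "p \<noteq> 0" and "\<forall>z. poly p z = 0 \<longrightarrow> z \<in> {z. Re z \<le> 0}" and y: "Re y > 0"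
  shows "Re y * (cmod (poly (pderiv p) y / poly p y))\<^sup>2 \<le> degree p * Re (poly (pderiv p) y / poly p y) \<and>
    (degree p > 0 \<longrightarrow> Re (poly (pderiv p) y / poly p y) > 0)"
  using assms(1,2)
proof (induction p rule: poly_induct_zeros)
  case (const c)
  then show ?case by (simp add: pderiv_pCons)
next
  case (factor a p)
  define L where "L = poly (pderiv p) y / poly p y"
  define u where "u = 1 / (y - a)"
  define n where "n = real (degree p)"
  have r: "Re (y - a) \<ge> Re y" "Re (y - a) > 0" using factor y by auto
  then have ne: "y \<noteq> a" by auto
  have py: "poly p y \<noteq> 0" using factor y by force
  have deg: "degree ([:-a,1:] * p) = Suc (degree p)" using factor degree_linear_mult by blast
  have pd: "pderiv ([:-a, 1:] * p) = [:-a, 1:] * pderiv p + p"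
    by (subst pderiv_mult) (simp add: pderiv_pCons)
  have L': "poly (pderiv ([:-a, 1:] * p)) y / poly ([:-a, 1:] * p) y = L + u"
    unfolding pd using ne py by (simp add: L_def u_def field_simps)
  have u1: "Re u = Re (y - a) * (cmod u)\<^sup>2"
    by (simp add: u_def Re_divide norm_divide power_divide cmod_power2)
  have u0: "cmod u > 0" using ne by (simp add: u_def)
  have u: "Re y * (cmod u)\<^sup>2 \<le> Re u" "Re u > 0" using r u0 unfolding u1 by (auto intro: mult_right_mono)
  have IH: "Re y * (cmod L)\<^sup>2 \<le> n * Re L" "n > 0 \<longrightarrow> Re L > 0" using factor.IH by (auto simp: L_def n_def)
  have "Re y * (cmod (L + u))\<^sup>2 \<le> (n + 1) * Re (L + u) \<and> Re (L + u) > 0"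
  proof (cases "degree p = 0")
    case True
    then obtain c where "p = [:c:]" by (metis degree_0_id)
    then have "L = 0" by (simp add: L_def pderiv_pCons)
    then show ?thesis using u True by (simp add: n_def)
  next
    case False
    then have n: "n > 0" by (simp add: n_def)
    have "(cmod (L + u))\<^sup>2 \<le> (cmod L + cmod u)\<^sup>2" by (intro power_mono norm_triangle_ineq) auto
    also have "\<dots> \<le> (n + 1) * ((cmod L)\<^sup>2 / n + (cmod u)\<^sup>2)"
    proof -
      \<comment> \<open>The square expands to \<open>2 |L| |u| <= |L|^2 / n + n |u|^2\<close>, which
        controls the cross term.\<close>
      have "0 \<le> (cmod L - n * cmod u)\<^sup>2 / n" using n by simp
      then show ?thesis using n by (simp add: power2_eq_square field_simps)
    qed
    finally have "Re y * (cmod (L + u))\<^sup>2 \<le> Re y * ((n + 1) * ((cmod L)\<^sup>2 / n + (cmod u)\<^sup>2))"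
      using y by (intro mult_left_mono) auto
    also have "\<dots> = (n + 1) * (Re y * (cmod L)\<^sup>2 / n + Re y * (cmod u)\<^sup>2)" by (simp add: algebra_simps)
    also have "\<dots> \<le> (n + 1) * (Re L + Re u)"
      using n u IH by (intro mult_left_mono add_mono) (auto simp: field_simps)
    finally show ?thesis using IH n u by simp
  qed
  then show ?case unfolding L' deg n_def by (simp add: algebra_simps)
qed

text \<open>The zero polynomial counts as stable, so that the class is closed under coefficientwise
  limits of bounded degree.\<close>

definition rhp_stable :: "complex poly \<Rightarrow> bool" where
  "rhp_stable p \<longleftrightarrow> p = 0 \<or> (\<forall>z. Re z > 0 \<longrightarrow> poly p z \<noteq> 0)"

text \<open>The common degree bound turns coefficientwise convergence into locally uniform
  convergence, and Hurwitz's theorem applies. It excludes constant limits, which are treated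
  directly.\<close>

lemma rhp_stable_limit:
  assumes st: "\<And>k. rhp_stable (q k)" and deg: "\<And>k. degree (q k) \<le> n"
    and lim: "\<And>j. (\<lambda>k. coeff (q k) j) \<longlonglongrightarrow> coeff p j"
  shows "rhp_stable p"
proof (cases "p = 0")
  case False
  have cz: "coeff p j = 0" if "j > n" for j
  proof -
    have "(\<lambda>k. coeff (q k) j) = (\<lambda>k. 0)" by (intro ext coeff_eq_0 le_less_trans[OF deg that])
    then show ?thesis using lim[of j] by (simp add: LIMSEQ_const_iff)
  qed
  then have degp: "degree p \<le> n" by (meson degree_le)
  have ev: "poly r z = (\<Sum>i\<le>n. coeff r i * z ^ i)" if "degree r \<le> n" for r :: "complex poly" and z
    unfolding poly_altdef using that by (intro sum.mono_neutral_left) (auto simp: coeff_eq_0)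
  have ul: "uniform_limit K (\<lambda>k. poly (q k)) (poly p) sequentially" if "compact K" for K
  proof -
    from that obtain R where R: "\<And>z. z \<in> K \<Longrightarrow> norm z \<le> R" using compact_imp_bounded bounded_iff by metis
    have "(\<lambda>k. \<Sum>i\<le>n. norm (coeff (q k) i - coeff p i) * R ^ i) \<longlonglongrightarrow> (\<Sum>i\<le>n. norm (coeff p i - coeff p i) * R ^ i)"
      by (intro tendsto_intros lim)
    then have l0: "(\<lambda>k. \<Sum>i\<le>n. norm (coeff (q k) i - coeff p i) * R ^ i) \<longlonglongrightarrow> 0" by simp
    have b: "dist (poly (q k) z) (poly p z) \<le> (\<Sum>i\<le>n. norm (coeff (q k) i - coeff p i) * R ^ i)" if "z \<in> K" for k z
    proof -
      have "dist (poly (q k) z) (poly p z) = norm (\<Sum>i\<le>n. (coeff (q k) i - coeff p i) * z ^ i)"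
        unfolding ev[OF degp] ev[OF deg] dist_norm by (simp add: sum_subtractf left_diff_distrib)
      also have "\<dots> \<le> (\<Sum>i\<le>n. norm ((coeff (q k) i - coeff p i) * z ^ i))" by (rule norm_sum)
      also have "\<dots> \<le> (\<Sum>i\<le>n. norm (coeff (q k) i - coeff p i) * R ^ i)"
        using R[OF that] by (intro sum_mono) (auto simp: norm_mult norm_power intro!: mult_left_mono power_mono)
      finally show ?thesis .
    qed
    show ?thesis
    proof (rule uniform_limitI)
      fix e :: real assume "e > 0"
      then have "\<forall>\<^sub>F k in sequentially. (\<Sum>i\<le>n. norm (coeff (q k) i - coeff p i) * R ^ i) < e"
        using order_tendstoD(2)[OF l0] by blast
      then show "\<forall>\<^sub>F k in sequentially. \<forall>z\<in>K. dist (poly (q k) z) (poly p z) < e"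
        by (rule eventually_mono) (use b le_less_trans in blast)
    qed
  qed
  let ?H = "{z. Re z > 0}"
  \<comment> \<open>Early \<open>q k\<close> may be stable only by being zero. A nonzero coefficient
    of the limit rules this out from some index \<open>k0\<close> on, hence the shift by
    \<open>k0\<close>.\<close>
  obtain j where j: "coeff p j \<noteq> 0" using False by (metis leading_coeff_neq_0)
  have "\<forall>\<^sub>F k in sequentially. coeff (q k) j \<noteq> 0" using tendsto_imp_eventually_ne[OF lim j] .
  then obtain k0 where k0: "\<And>k. k \<ge> k0 \<Longrightarrow> coeff (q k) j \<noteq> 0" by (auto simp: eventually_sequentially)
  have nz: "poly (q (k + k0)) z \<noteq> 0" if "z \<in> ?H" for k z
    using st[of "k + k0"] k0[of "k + k0"] that by (auto simp: rhp_stable_def)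
  have "poly p z \<noteq> 0" if z: "z \<in> ?H" for z
  proof (cases "poly p constant_on ?H")
    case True
    have inf: "infinite ?H"
      using finite_imp_not_open[of ?H] open_halfspace_Re_gt[of 0] z by auto
    obtain c where c: "\<And>x. x \<in> ?H \<Longrightarrow> poly p x = c" using True by (auto simp: constant_on_def)
    have "p - [:c:] = 0"
    proof (rule ccontr)
      assume "p - [:c:] \<noteq> 0"
      then have "finite {x. poly (p - [:c:]) x = 0}" by (rule poly_roots_finite)
      moreover have "?H \<subseteq> {x. poly (p - [:c:]) x = 0}" using c by auto
      ultimately show False using inf finite_subset by blast
    qed
    then show ?thesis using False by auto
  next
    case ncon: False
    show ?thesis
    proof (rule Hurwitz_no_zeros[where S = ?H and \<F> = "\<lambda>k. poly (q (k + k0))" and g = "poly p" and ?z0.0 = z])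
      show "open ?H" by (rule open_halfspace_Re_gt)
      show "connected ?H" by (simp add: convex_connected convex_halfspace_Re_gt)
      show "uniform_limit K (\<lambda>k. poly (q (k + k0))) (poly p) sequentially" if "compact K" for K
        using filterlim_compose[OF ul[OF that] filterlim_add_const_nat_at_top[of k0]] .
    qed (use ncon nz z in \<open>auto intro!: holomorphic_intros\<close>)
  qed
  then show ?thesis by (auto simp: rhp_stable_def)
qed (simp add: rhp_stable_def)

section \<open>Jensen polynomials and polar derivatives\<close>

definition jensen :: "nat \<Rightarrow> (nat \<Rightarrow> complex) \<Rightarrow> complex poly" where
  "jensen n b = (\<Sum>j\<le>n. monom (of_nat (n choose j) * b j) j)"

lemma coeff_jensen: "coeff (jensen n b) j = of_nat (n choose j) * b j"
  by (auto simp: jensen_def coeff_sum coeff_monom binomial_eq_0)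

lemma degree_jensen: "degree (jensen n b) \<le> n"
  by (rule degree_le) (auto simp: coeff_jensen binomial_eq_0)

text \<open>\<open>apply_deriv p n\<close> is \<open>p(D)\<close> applied to \<open>z^n\<close>; its reversal is a Jensen polynomial of \<open>p\<close>.\<close>

definition apply_deriv :: "complex poly \<Rightarrow> nat \<Rightarrow> complex poly" where
  "apply_deriv p n = (\<Sum>i\<le>n. monom (fact n / fact i * coeff p (n - i)) i)"

lemma coeff_apply_deriv: "coeff (apply_deriv p n) i = (if i \<le> n then fact n / fact i * coeff p (n - i) else 0)"
  by (auto simp: apply_deriv_def coeff_sum coeff_monom)

text \<open>In \<open>p(D)\<close> a factor \<open>z - a\<close> of \<open>p\<close> becomes
  \<open>D - a\<close>, so \<open>p(D) z^n\<close> arises from a multiple of \<open>z^n\<close> by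
  one such operator for each zero of \<open>p\<close>.\<close>

lemma apply_deriv_factor:
  "apply_deriv ([:-a, 1:] * p) n = pderiv (apply_deriv p n) - smult a (apply_deriv p n)"
proof (rule poly_eqI)
  fix i
  consider "i > n" | "i = n" | "i < n" by linarith
  then show "coeff (apply_deriv ([:-a, 1:] * p) n) i = coeff (pderiv (apply_deriv p n) - smult a (apply_deriv p n)) i"
  proof cases
    case 3
    then obtain m where n: "n = Suc (i + m)" using less_imp_Suc_add by blast
    have f: "of_nat (Suc i) * (fact n / fact (Suc i) * c) = fact n / fact i * (c :: complex)" for c
      by (simp add: fact_Suc field_simps del: of_nat_Suc)
    have "coeff ([:-a, 1:] * p) (n - i) = coeff p m - a * coeff p (Suc m)" by (simp add: n)
    then show ?thesis
      using 3 f[of "coeff p m"] by (simp add: coeff_apply_deriv coeff_pderiv n right_diff_distrib del: fact_Suc of_nat_Suc)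
  qed (auto simp: coeff_apply_deriv coeff_pderiv coeff_pCons)
qed

text \<open>A zero of \<open>g' - a g\<close> in the right half-plane would give
  \<open>g'/g = a\<close> there, but \<open>Re (g'/g) > 0\<close> for nonconstant \<open>g\<close>
  by \<open>log_deriv_bound\<close>.\<close>

lemma rhp_stable_deriv_diff:
  assumes st: "rhp_stable g" and a: "Re a \<le> 0"
  shows "rhp_stable (pderiv g - smult a g)"
proof (cases "g = 0")
  case False
  show ?thesis
  proof (cases "degree g = 0")
    case True
    then obtain c where "g = [:c:]" by (metis degree_0_id)
    then show ?thesis by (auto simp: rhp_stable_def pderiv_pCons)
  next
    case deg: False
    have zeros: "\<forall>z. poly g z = 0 \<longrightarrow> z \<in> {z. Re z \<le> 0}" using st False by (force simp: rhp_stable_def)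
    have "poly (pderiv g - smult a g) y \<noteq> 0" if y: "Re y > 0" for y
    proof
      assume "poly (pderiv g - smult a g) y = 0"
      moreover have "poly g y \<noteq> 0" using zeros y by force
      ultimately have "poly (pderiv g) y / poly g y = a" by (simp add: field_simps)
      then show False using log_deriv_bound[OF False zeros y] deg a by auto
    qed
    then show ?thesis by (simp add: rhp_stable_def)
  qed
qed (simp add: rhp_stable_def)

lemma rhp_stable_apply_deriv:
  assumes "rhp_stable p"
  shows "rhp_stable (apply_deriv p n)"
proof (cases "p = 0")
  case True
  then show ?thesis by (simp add: apply_deriv_def rhp_stable_def)
next
  case False
  then have "\<forall>z. poly p z = 0 \<longrightarrow> z \<in> {z. Re z \<le> 0}" using assms by (force simp: rhp_stable_def)
  with False show ?thesis
  proof (induction p rule: poly_induct_zeros)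
    case (const c)
    have "apply_deriv [:c:] n = monom c n"
      by (rule poly_eqI) (auto simp: coeff_apply_deriv coeff_pCons split: nat.splits)
    then show ?case using const by (auto simp: rhp_stable_def poly_monom)
  next
    case (factor a p)
    then show ?case unfolding apply_deriv_factor by (intro rhp_stable_deriv_diff) auto
  qed
qed

text \<open>The Jensen polynomial is the reversal \<open>y^n g(1/y)\<close> of
  \<open>g = p(D) z^n\<close>, and \<open>1/y\<close> stays in the right half-plane with
  \<open>y\<close>.\<close>

lemma rhp_stable_jensen:
  assumes "rhp_stable p"
  shows "rhp_stable (jensen n (\<lambda>j. fact j * coeff p j))"
proof -
  have ev: "poly (jensen n (\<lambda>j. fact j * coeff p j)) y = y ^ n * poly (apply_deriv p n) (1 / y)" if "y \<noteq> 0" for y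
  proof -
    have "poly (apply_deriv p n) (1 / y) = (\<Sum>i\<le>n. fact n / fact i * coeff p (n - i) * (1 / y) ^ i)"
      by (simp add: apply_deriv_def poly_sum poly_monom)
    also have "\<dots> = (\<Sum>i\<le>n. fact n / fact (n - i) * coeff p i * (1 / y) ^ (n - i))"
      by (subst sum.atLeastAtMost_rev[of _ 0 n, unfolded atLeast0AtMost]) simp
    also have "y ^ n * \<dots> = (\<Sum>i\<le>n. of_nat (n choose i) * (fact i * coeff p i) * y ^ i)"
      unfolding sum_distrib_left
    proof (rule sum.cong)
      fix i assume "i \<in> {..n}"
      then have "y ^ n = y ^ i * y ^ (n - i)" by (simp flip: power_add)
      then show "y ^ n * (fact n / fact (n - i) * coeff p i * (1 / y) ^ (n - i)) = of_nat (n choose i) * (fact i * coeff p i) * y ^ i"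
        using that \<open>i \<in> {..n}\<close> by (simp add: binomial_fact field_simps)
    qed simp
    also have "\<dots> = poly (jensen n (\<lambda>j. fact j * coeff p j)) y" by (simp add: jensen_def poly_sum poly_monom)
    finally show ?thesis by simp
  qed
  show ?thesis
  proof (cases "apply_deriv p n = 0")
    case True
    have "coeff p j = 0" if "j \<le> n" for j
      using arg_cong[OF True, of "\<lambda>q. coeff q (n - j)"] that by (simp add: coeff_apply_deriv)
    then have "jensen n (\<lambda>j. fact j * coeff p j) = 0" by (simp add: jensen_def)
    then show ?thesis by (simp add: rhp_stable_def)
  next
    case False
    have "poly (jensen n (\<lambda>j. fact j * coeff p j)) y \<noteq> 0" if "Re y > 0" for y
    proof -
      have "y \<noteq> 0" using that by auto
      moreover have "Re (1 / y) > 0" using that \<open>y \<noteq> 0\<close>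
        by (auto simp: Re_divide intro!: divide_pos_pos sum_power2_gt_zero_iff[THEN iffD2])
      ultimately show ?thesis using rhp_stable_apply_deriv[OF assms, of n] False ev by (auto simp: rhp_stable_def)
    qed
    then show ?thesis by (simp add: rhp_stable_def)
  qed
qed

text \<open>Laguerre's theorem on polar derivatives: the polar derivative of \<open>jensen (Suc n) b\<close> with pole \<open>x\<close>
  is, up to a factor, the polynomial in the conclusion.\<close>

lemma jensen_polar:
  assumes nz: "\<And>y. Re y > 0 \<Longrightarrow> poly (jensen (Suc n) b) y \<noteq> 0" and x: "Re x > 0" and y: "Re y > 0"
  shows "poly (jensen n (\<lambda>j. b j + x * b (Suc j))) y \<noteq> 0"
proof
  define f where "f = jensen (Suc n) b"
  define L where "L = poly (pderiv f) y / poly f y"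
  \<comment> \<open>The right side is the polar derivative of \<open>f\<close>, taken with formal
    degree \<open>Suc n\<close>.\<close>
  have id: "smult (of_nat (Suc n)) (jensen n (\<lambda>j. b j + x * b (Suc j))) =
      smult (of_nat (Suc n)) f + [:x, -1:] * pderiv f"
  proof (rule poly_eqI)
    fix j
    have 1: "of_nat (Suc n) * of_nat (n choose j) = (of_nat (Suc j) * of_nat (Suc n choose Suc j) :: complex)"
      using Suc_times_binomial[of j n] by (metis of_nat_mult mult.commute)
    have 2: "of_nat (Suc n) * of_nat (Suc n choose j) - of_nat j * of_nat (Suc n choose j) =
        (of_nat (Suc n) * of_nat (n choose j) :: complex)"
    proof (cases j)
      case (Suc i)
      have "of_nat (Suc n) * of_nat (n choose i) = (of_nat (Suc i) * of_nat (Suc n choose Suc i) :: complex)"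
        using Suc_times_binomial[of i n] by (metis of_nat_mult mult.commute)
      then show ?thesis unfolding Suc by (simp add: algebra_simps)
    qed simp
    have alg: "N * (C0 * (u + x * v)) = N * (C1 * u) + (x * (J * (C2 * v)) - i * (C1 * u))"
      if "N * C0 = J * C2" "N * C1 - i * C1 = N * C0" for N C0 C1 C2 J i u v :: complex
      using that by algebra
    have "coeff ([:x, -1:] * pderiv f) j = x * (of_nat (Suc j) * (of_nat (Suc n choose Suc j) * b (Suc j))) -
        of_nat j * (of_nat (Suc n choose j) * b j)"
      by (cases j) (simp_all add: f_def coeff_pderiv coeff_jensen del: binomial_Suc_Suc of_nat_Suc)
    then show "coeff (smult (of_nat (Suc n)) (jensen n (\<lambda>j. b j + x * b (Suc j)))) j =
      coeff (smult (of_nat (Suc n)) f + [:x, -1:] * pderiv f) j"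
      using alg[OF 1 2, of "b j" "b (Suc j)"] by (simp add: coeff_jensen f_def del: binomial_Suc_Suc of_nat_Suc mult_pCons_left)
  qed
  assume "poly (jensen n (\<lambda>j. b j + x * b (Suc j))) y = 0"
  then have 0: "of_nat (Suc n) * poly f y + (x - y) * poly (pderiv f) y = 0"
    using arg_cong[OF id, of "\<lambda>q. poly q y"] by (simp add: algebra_simps)
  have fy: "poly f y \<noteq> 0" using nz[OF y] by (simp add: f_def)
  then have L: "(y - x) * L = of_nat (Suc n)" using 0 by (simp add: L_def field_simps)
  have "f \<noteq> 0" using fy by auto
  moreover have "\<forall>z. poly f z = 0 \<longrightarrow> z \<in> {z. Re z \<le> 0}" using nz by (force simp: f_def)
  ultimately have B: "Re y * (cmod L)\<^sup>2 \<le> degree f * Re L" unfolding L_def using log_deriv_bound y by blast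
  have "L \<noteq> 0" using L by (metis mult_zero_right of_nat_neq_0)
  then have "cmod L > 0" by simp
  \<comment> \<open>The true degree of \<open>f\<close> may be below \<open>Suc n\<close>. Since
    \<open>Re L\<close> is non-negative, the bound survives replacing the one by the other.\<close>
  have "Re L \<ge> 0"
  proof (rule ccontr)
    assume "\<not> Re L \<ge> 0"
    then have "degree f * Re L \<le> 0" by (simp add: mult_nonneg_nonpos)
    moreover have "Re y * (cmod L)\<^sup>2 > 0" using y \<open>cmod L > 0\<close> by simp
    ultimately show False using B by linarith
  qed
  then have "Re y * (cmod L)\<^sup>2 \<le> real (Suc n) * Re L"
    using B degree_jensen[of "Suc n" b] mult_right_mono[of "real (degree f)" "real (Suc n)" "Re L"] by (simp add: f_def)
  \<comment> \<open>Substituting \<open>of_nat (Suc n) = (y - x) * L\<close> turns the bound into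
    \<open>Re y |L|^2 <= Re (y - x) |L|^2\<close>, against \<open>Re x > 0\<close>.\<close>
  also have "real (Suc n) * Re L = Re (of_nat (Suc n) * cnj L)" by simp
  also have "\<dots> = Re ((y - x) * (L * cnj L))" unfolding L[symmetric] by (simp add: mult.assoc)
  also have "\<dots> = Re (y - x) * (cmod L)\<^sup>2" unfolding complex_norm_square[symmetric] by simp
  finally show False using x \<open>cmod L > 0\<close> by simp
qed

section \<open>Coefficientwise limits of polynomials with non-positive zeros\<close>

abbreviation P_plus0 :: "complex poly set" where
  "P_plus0 \<equiv> P_plus \<union> {0}"

lemma coeff_linear_mult:
  "coeff ([:r, 1:] * p) i = r * coeff p i + (if i = 0 then 0 else coeff p (i - 1))"
  for r :: "'a :: comm_semiring_1"
  by (cases i) auto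

lemma P_plus0_coeff:
  assumes "p \<in> P_plus0"
  shows "coeff p i \<in> \<real>\<^sub>\<ge>\<^sub>0"
proof (cases "p = 0")
  case False
  then have "\<forall>z. poly p z = 0 \<longrightarrow> z \<in> \<real>\<^sub>\<le>\<^sub>0" and "lead_coeff p \<in> \<real>\<^sub>\<ge>\<^sub>0" using assms by (auto simp: P_plus_def)
  with False show ?thesis
  proof (induction p arbitrary: i rule: poly_induct_zeros)
    case (const c)
    then show ?case by (auto simp: coeff_pCons split: nat.splits)
  next
    case (factor a p)
    have "lead_coeff ([:-a, 1:] * p) = lead_coeff p" by (subst lead_coeff_mult) simp
    then have "coeff p i \<in> \<real>\<^sub>\<ge>\<^sub>0" for i using factor by metis
    moreover have "- a \<in> \<real>\<^sub>\<ge>\<^sub>0" using factor.hyps(1) by simp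
    ultimately show ?case unfolding coeff_linear_mult
      by (metis nonneg_Reals_add_I nonneg_Reals_mult_I nonneg_Reals_zero_I)
  qed
qed auto

text \<open>The substitution of \<open>\<i> * z\<close> makes stability mean that no zero lies in
  the upper half-plane. Real coefficients reflect this to the lower one, and non-negative
  coefficients exclude positive zeros.\<close>

lemma P_plus0I:
  assumes coef: "\<And>i. coeff p i \<in> \<real>\<^sub>\<ge>\<^sub>0" and st: "rhp_stable (p \<circ>\<^sub>p [:0, \<i>:])"
  shows "p \<in> P_plus0"
proof (cases "p = 0")
  case False
  then have "p \<circ>\<^sub>p [:0, \<i>:] \<noteq> 0" by (simp add: pcompose_eq_0_iff)
  then have up: "poly p w \<noteq> 0" if "Im w > 0" for w
  proof -
    have "poly (p \<circ>\<^sub>p [:0, \<i>:]) (- \<i> * w) = poly p w" by (simp add: poly_pcompose mult.commute[of _ \<i>])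
    moreover have "Re (- \<i> * w) > 0" using that by simp
    ultimately show ?thesis using st \<open>p \<circ>\<^sub>p [:0, \<i>:] \<noteq> 0\<close> unfolding rhp_stable_def by metis
  qed
  have real: "coeff p i \<in> \<real>" for i using coef by blast
  have "z \<in> \<real>\<^sub>\<le>\<^sub>0" if z: "poly p z = 0" for z
  proof -
    have "poly p (cnj z) = 0" using real_poly_cnj_root_iff[OF real] z by simp
    then have im: "Im z = 0" using up[of z] up[of "cnj z"] z by (cases "Im z" "0::real" rule: linorder_cases) auto
    have "Re z \<le> 0"
    proof (rule ccontr)
      assume pos: "\<not> Re z \<le> 0"
      have z': "z = of_real (Re z)" using im by (simp add: complex_eq_iff)
      have "Re (poly p z) = (\<Sum>i\<le>degree p. Re (coeff p i) * Re z ^ i)"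
        by (subst z') (simp add: poly_altdef flip: of_real_power)
      moreover have "\<dots> > 0"
      proof (rule sum_pos2)
        have "lead_coeff p \<noteq> 0" "lead_coeff p \<in> \<real>\<^sub>\<ge>\<^sub>0" using False coef by auto
        then have "Re (lead_coeff p) > 0" by (auto simp: complex_nonneg_Reals_iff complex_eq_iff less_le)
        then show "0 < Re (coeff p (degree p)) * Re z ^ degree p" using pos by simp
        show "0 \<le> Re (coeff p i) * Re z ^ i" for i using coef[of i] pos by (simp add: complex_nonneg_Reals_iff)
      qed auto
      ultimately show False using z by simp
    qed
    then show ?thesis using im by (simp add: complex_nonpos_Reals_iff)
  qed
  then show ?thesis using False coef by (simp add: P_plus_def)
qed simp

lemma P_plus0_stable:
  assumes "p \<in> P_plus0"
  shows "rhp_stable (p \<circ>\<^sub>p [:0, \<i>:])"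
  using assms by (auto simp: P_plus_def rhp_stable_def poly_pcompose complex_nonpos_Reals_iff)

lemma P_plus0_scale:
  assumes p: "p \<in> P_plus0" and "c > 0"
  shows "p \<circ>\<^sub>p [:0, of_real c:] \<in> P_plus0"
proof (rule P_plus0I)
  show "coeff (p \<circ>\<^sub>p [:0, of_real c:]) i \<in> \<real>\<^sub>\<ge>\<^sub>0" for i
    using P_plus0_coeff[OF p] assms(2) by (simp add: coeff_pcompose_linear)
  show "rhp_stable (p \<circ>\<^sub>p [:0, of_real c:] \<circ>\<^sub>p [:0, \<i>:])"
    using p assms(2) by (auto simp: P_plus_def rhp_stable_def poly_pcompose complex_nonpos_Reals_iff)
qed

text \<open>With \<open>m = 0\<close>, this says that \<open>p 1 * p - p 0 * p'\<close> has non-negative coefficients; it bounds the growth of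
  the coefficients in a coefficientwise limit.\<close>

lemma P_plus0_newton:
  assumes "p \<in> P_plus0" and "\<And>i. i < m \<Longrightarrow> coeff p i = 0"
  shows "coeff p (Suc m) * coeff p (m + j) - of_nat (Suc j) * coeff p m * coeff p (Suc (m + j)) \<in> \<real>\<^sub>\<ge>\<^sub>0"
  using assms
proof (induction m arbitrary: p)
  case 0
  show ?case
  proof (cases "p = 0")
    case False
    then have "\<forall>z. poly p z = 0 \<longrightarrow> z \<in> \<real>\<^sub>\<le>\<^sub>0" and "lead_coeff p \<in> \<real>\<^sub>\<ge>\<^sub>0" using 0 by (auto simp: P_plus_def)
    with False have "coeff p 1 * coeff p j - of_nat (Suc j) * coeff p 0 * coeff p (Suc j) \<in> \<real>\<^sub>\<ge>\<^sub>0"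
    proof (induction p arbitrary: j rule: poly_induct_zeros)
      case (const c)
      then show ?case by simp
    next
      case (factor a p)
      define r where "r = - a"
      have r: "r \<in> \<real>\<^sub>\<ge>\<^sub>0" using factor by (simp add: r_def)
      have lc: "lead_coeff ([:-a, 1:] * p) = lead_coeff p" by (subst lead_coeff_mult) simp
      have IH: "coeff p 1 * coeff p j - of_nat (Suc j) * coeff p 0 * coeff p (Suc j) \<in> \<real>\<^sub>\<ge>\<^sub>0" for j
        using factor.IH factor.prems unfolding lc by blast
      have "p \<in> P_plus0" using factor.hyps factor.prems unfolding lc by (simp add: P_plus_def)
      then have c: "coeff p i \<in> \<real>\<^sub>\<ge>\<^sub>0" for i by (rule P_plus0_coeff)
      have "coeff ([:r, 1:] * p) 1 * coeff ([:r, 1:] * p) j -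
          of_nat (Suc j) * coeff ([:r, 1:] * p) 0 * coeff ([:r, 1:] * p) (Suc j) \<in> \<real>\<^sub>\<ge>\<^sub>0"
      proof (cases j)
        case 0
        then show ?thesis by (simp add: coeff_linear_mult algebra_simps)
      next
        case (Suc i)
        \<comment> \<open>If \<open>E j\<close> is the expression for \<open>p\<close>, the one for
          \<open>(r + z) p\<close> is \<open>r^2 E j + r E (j - 1)\<close> plus a product of
          coefficients of \<open>p\<close>.\<close>
        have "coeff ([:r, 1:] * p) 1 * coeff ([:r, 1:] * p) j -
            of_nat (Suc j) * coeff ([:r, 1:] * p) 0 * coeff ([:r, 1:] * p) (Suc j) =
          r * r * (coeff p 1 * coeff p j - of_nat (Suc j) * coeff p 0 * coeff p (Suc j)) +
          r * (coeff p 1 * coeff p i - of_nat (Suc i) * coeff p 0 * coeff p (Suc i)) + coeff p 0 * coeff p i"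
          unfolding coeff_linear_mult by (simp add: Suc algebra_simps)
        also have "\<dots> \<in> \<real>\<^sub>\<ge>\<^sub>0" by (intro nonneg_Reals_add_I nonneg_Reals_mult_I r IH c)
        finally show ?thesis .
      qed
      then show ?case by (simp only: r_def)
    qed
    then show ?thesis by simp
  qed simp
next
  case (Suc m)
  \<comment> \<open>The vanishing low coefficients are powers of \<open>z\<close>, which are divided
    out one by one.\<close>
  obtain a q where p: "p = pCons a q" by (cases p)
  with Suc.prems(2)[of 0] have a: "a = 0" by simp
  have q: "q \<in> P_plus0"
    using Suc.prems(1) unfolding p a by (cases "q = 0") (auto simp: P_plus_def)
  have "\<And>i. i < m \<Longrightarrow> coeff q i = 0" using Suc.prems(2)[of "Suc i" for i] by (simp add: p)
  from Suc.IH[OF q this] show ?case by (simp add: p)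
qed

text \<open>For fixed \<open>n\<close> only the coefficients up to \<open>n\<close> enter, so the
  limit is one of bounded degree even if the degrees of \<open>q k\<close> are unbounded. The
  \<open>q k\<close> need only be stable after rotation; the signs are asked of the limit
  alone.\<close>

lemma jensen_P_plus0:
  assumes st: "\<And>k. rhp_stable (q k \<circ>\<^sub>p [:0, \<i>:])" and lim: "\<And>j. (\<lambda>k. coeff (q k) j) \<longlonglongrightarrow> c j"
    and c: "\<And>j. c j \<in> \<real>\<^sub>\<ge>\<^sub>0"
  shows "jensen n (\<lambda>j. fact j * c j) \<in> P_plus0"
proof (rule P_plus0I)
  show "coeff (jensen n (\<lambda>j. fact j * c j)) i \<in> \<real>\<^sub>\<ge>\<^sub>0" for i
    unfolding coeff_jensen using c
    by (intro nonneg_Reals_mult_I nonneg_Reals_of_nat_I) (auto simp: complex_nonneg_Reals_iff)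
  show "rhp_stable (jensen n (\<lambda>j. fact j * c j) \<circ>\<^sub>p [:0, \<i>:])"
  proof (rule rhp_stable_limit)
    show "rhp_stable (jensen n (\<lambda>j. fact j * coeff (q k \<circ>\<^sub>p [:0, \<i>:]) j))" for k
      by (rule rhp_stable_jensen[OF st])
    show "degree (jensen n (\<lambda>j. fact j * coeff (q k \<circ>\<^sub>p [:0, \<i>:]) j)) \<le> n" for k
      by (rule degree_jensen)
    have "(\<lambda>k. of_nat (n choose j) * (fact j * (\<i> ^ j * coeff (q k) j))) \<longlonglongrightarrow>
        of_nat (n choose j) * (fact j * (\<i> ^ j * c j))" for j
      by (intro tendsto_intros lim)
    then show "(\<lambda>k. coeff (jensen n (\<lambda>j. fact j * coeff (q k \<circ>\<^sub>p [:0, \<i>:]) j)) j) \<longlonglongrightarrow>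
        coeff (jensen n (\<lambda>j. fact j * c j) \<circ>\<^sub>p [:0, \<i>:]) j" for j
      by (simp add: coeff_jensen coeff_pcompose_linear mult_ac)
  qed
qed

section \<open>Rescaled Jensen polynomials as approximants\<close>

text \<open>This is \<open>n (n - 1) ... (n - j + 1) / n^j\<close>, the damping of the
  \<open>j\<close>-th coefficient when the \<open>n\<close>-th Jensen polynomial is evaluated at
  \<open>z/n\<close>.\<close>

definition jensen_weight :: "nat \<Rightarrow> nat \<Rightarrow> real" where
  "jensen_weight n j = real (n choose j) * fact j / real n ^ j"

lemma jensen_weight_bounds: "0 \<le> jensen_weight n j" "jensen_weight n j \<le> 1"
proof -
  have "real ((n choose j) * fact j) \<le> real (n ^ j)" by (rule of_nat_mono[OF binomial_fact_pow])
  then show "jensen_weight n j \<le> 1" 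
    by (cases "real n ^ j = 0") (simp_all add: jensen_weight_def divide_le_eq)
qed (simp add: jensen_weight_def)

lemma jensen_weight_pos: "j \<le> n \<Longrightarrow> 0 < jensen_weight n j"
  by (cases "n = 0") (auto simp: jensen_weight_def)

lemma jensen_weight_tendsto: "(\<lambda>n. jensen_weight n j) \<longlonglongrightarrow> 1"
proof (induction j)
  case 0
  then show ?case by (simp add: jensen_weight_def)
next
  case (Suc j)
  have "(\<lambda>n. 1 - real j / real n) \<longlonglongrightarrow> 1 - 0" by (intro tendsto_intros lim_const_over_n)
  then have "(\<lambda>n. jensen_weight n j * (1 - real j / real n)) \<longlonglongrightarrow> 1"
    using tendsto_mult[OF Suc, of "\<lambda>n. 1 - real j / real n" "1 - 0"] by simp
  moreover have "\<forall>\<^sub>F n in sequentially. jensen_weight n j * (1 - real j / real n) = jensen_weight n (Suc j)"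
    using eventually_gt_at_top[of j]
  proof eventually_elim
    case (elim n)
    have absorb: "Suc j * (n choose Suc j) = (n - j) * (n choose j)"
      using binomial_absorption[of j n] binomial_absorb_comp[of n j] by simp
    have "real (Suc j) * real (n choose Suc j) = (real n - real j) * real (n choose j)"
      using arg_cong[OF absorb, of real] unfolding of_nat_mult of_nat_diff[OF less_imp_le[OF elim]] .
    then have "real (n choose Suc j) * fact (Suc j) = (real n - real j) * real (n choose j) * fact j"
      by (simp only: fact_Suc) (simp add: mult_ac)
    then have "jensen_weight n (Suc j) = (real n - real j) * real (n choose j) * fact j / real n ^ Suc j"
      by (simp only: jensen_weight_def)
    also have "\<dots> = jensen_weight n j * ((real n - real j) / real n)"
      by (simp add: jensen_weight_def mult_ac)
    also have "(real n - real j) / real n = 1 - real j / real n" using elim by (simp add: diff_divide_distrib)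
    finally show ?case by simp
  qed
  ultimately show ?case by (rule Lim_transform_eventually)
qed

lemma coeff_jensen_scaled:
  "coeff (jensen n (\<lambda>j. fact j * c j) \<circ>\<^sub>p [:0, of_real (1 / real n):]) j = of_real (jensen_weight n j) * c j"
  by (simp add: coeff_pcompose_linear coeff_jensen jensen_weight_def power_divide)

lemma coeff_jensen_scaled_tendsto:
  "(\<lambda>n. coeff (jensen n (\<lambda>j. fact j * c j) \<circ>\<^sub>p [:0, of_real (1 / real n):]) j) \<longlonglongrightarrow> c j"
  unfolding coeff_jensen_scaled
  using tendsto_mult[OF tendsto_of_real[OF jensen_weight_tendsto] tendsto_const] by force

text \<open>The inequality of \<open>P_plus0_newton\<close> passes to the limit and becomes a
  recursion: each coefficient is at most a fixed ratio over \<open>Suc j\<close> times its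
  predecessor.\<close>

lemma P_plus0_limit_factorial_bound:
  assumes q: "\<And>k. q k \<in> P_plus0" and lim: "\<And>j. (\<lambda>k. coeff (q k) j) \<longlonglongrightarrow> c j"
    and m: "c m \<noteq> 0" "\<And>j. j < m \<Longrightarrow> c j = 0"
  shows "Re (c (m + j)) \<le> Re (c m) * (Re (c (Suc m)) / Re (c m)) ^ j / fact j"
proof -
  have c: "c j \<in> \<real>\<^sub>\<ge>\<^sub>0" for j
    by (rule closed_sequentially[OF closed_nonneg_Reals_complex _ lim]) (use P_plus0_coeff[OF q] in blast)
  then have c0: "Re (c j) \<ge> 0" for j by (simp add: complex_nonneg_Reals_iff)
  have cr: "c j = of_real (Re (c j))" for j using c[of j] by (simp add: complex_nonneg_Reals_iff complex_eq_iff)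
  \<comment> \<open>The coefficients of \<open>Q n\<close> below \<open>m\<close> vanish exactly, as
    \<open>P_plus0_newton\<close> demands; those of \<open>q k\<close> are only known to tend to
    0.\<close>
  define Q where "Q n = jensen n (\<lambda>j. fact j * c j) \<circ>\<^sub>p [:0, of_real (1 / real n):]" for n
  have Q: "Q n \<in> P_plus0" if "n > 0" for n
    unfolding Q_def using jensen_P_plus0[OF P_plus0_stable[OF q] lim c] that by (intro P_plus0_scale) auto
  have Qlim: "(\<lambda>n. coeff (Q n) j) \<longlonglongrightarrow> c j" for j
    unfolding Q_def by (rule coeff_jensen_scaled_tendsto)
  have step: "Re (c (Suc m)) * Re (c (m + j)) - real (Suc j) * Re (c m) * Re (c (Suc (m + j))) \<ge> 0" for j
  proof -
    have "c (Suc m) * c (m + j) - of_nat (Suc j) * c m * c (Suc (m + j)) \<in> \<real>\<^sub>\<ge>\<^sub>0"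
    proof (rule Lim_in_closed_set[OF closed_nonneg_Reals_complex])
      show "(\<lambda>n. coeff (Q n) (Suc m) * coeff (Q n) (m + j) - of_nat (Suc j) * coeff (Q n) m * coeff (Q n) (Suc (m + j)))
          \<longlonglongrightarrow> c (Suc m) * c (m + j) - of_nat (Suc j) * c m * c (Suc (m + j))"
        by (intro tendsto_intros Qlim)
      show "\<forall>\<^sub>F n in sequentially. coeff (Q n) (Suc m) * coeff (Q n) (m + j) -
          of_nat (Suc j) * coeff (Q n) m * coeff (Q n) (Suc (m + j)) \<in> \<real>\<^sub>\<ge>\<^sub>0"
        using eventually_gt_at_top[of 0]
      proof eventually_elim
        case (elim n)
        then show ?case using m(2) by (intro P_plus0_newton Q) (simp_all only: Q_def coeff_jensen_scaled mult_zero_right)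
      qed
    qed auto
    moreover have "c (Suc m) * c (m + j) - of_nat (Suc j) * c m * c (Suc (m + j)) =
        of_real (Re (c (Suc m)) * Re (c (m + j)) - real (Suc j) * Re (c m) * Re (c (Suc (m + j))))"
      using cr[of "Suc m"] cr[of "m + j"] cr[of m] cr[of "Suc (m + j)"] by (metis of_real_diff of_real_mult of_real_of_nat_eq)
    ultimately show ?thesis by (simp only: nonneg_Reals_of_real_iff)
  qed
  have cm: "Re (c m) > 0" using c0[of m] cr[of m] m(1) by (metis less_le of_real_0)
  show ?thesis
  proof (induction j)
    case (Suc j)
    have "Re (c (Suc (m + j))) \<le> Re (c (Suc m)) / Re (c m) * Re (c (m + j)) / real (Suc j)"
      using step[of j] cm by (simp add: field_simps del: of_nat_Suc)
    also have "\<dots> \<le> Re (c (Suc m)) / Re (c m) * (Re (c m) * (Re (c (Suc m)) / Re (c m)) ^ j / fact j) / real (Suc j)"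
      using c0 by (intro divide_right_mono mult_left_mono Suc) auto
    also have "\<dots> = Re (c m) * (Re (c (Suc m)) / Re (c m)) ^ Suc j / fact (Suc j)" by (simp add: fact_Suc del: of_nat_Suc)
    finally show ?case by simp
  qed simp
qed

lemma P_plus0_limit_summable:
  assumes q: "\<And>k. q k \<in> P_plus0" and lim: "\<And>j. (\<lambda>k. coeff (q k) j) \<longlonglongrightarrow> c j"
    and m: "c m \<noteq> 0" "\<And>j. j < m \<Longrightarrow> c j = 0"
  shows "summable (\<lambda>j. c j * z ^ j)"
proof -
  define t where "t = Re (c (Suc m)) / Re (c m)"
  have c: "c j \<in> \<real>\<^sub>\<ge>\<^sub>0" for j
    by (rule closed_sequentially[OF closed_nonneg_Reals_complex _ lim]) (use P_plus0_coeff[OF q] in blast)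
  have major: "summable (\<lambda>j. Re (c m) * norm z ^ m * (inverse (fact j) * (t * norm z) ^ j))"
    by (intro summable_mult summable_exp)
  have bound: "norm (c (j + m) * z ^ (j + m)) \<le> Re (c m) * norm z ^ m * (inverse (fact j) * (t * norm z) ^ j)" for j
  proof -
    have "norm (c (j + m) * z ^ (j + m)) = Re (c (m + j)) * norm z ^ (j + m)"
      using nonneg_Reals_cmod_eq_Re[OF c] by (simp add: norm_mult norm_power add.commute)
    also have "\<dots> \<le> (Re (c m) * t ^ j / fact j) * norm z ^ (j + m)"
      using P_plus0_limit_factorial_bound[OF q lim m, of j] by (intro mult_right_mono) (auto simp: t_def)
    also have "\<dots> = Re (c m) * norm z ^ m * (inverse (fact j) * (t * norm z) ^ j)"
      by (simp add: power_add power_mult_distrib divide_inverse mult_ac)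
    finally show ?thesis .
  qed
  have "summable (\<lambda>j. c (j + m) * z ^ (j + m))"
    by (rule summable_comparison_test'[OF major, of 0]) (rule bound)
  then show ?thesis by (simp only: summable_iff_shift[of "\<lambda>j. c j * z ^ j" m])
qed

section \<open>Coefficientwise limits and the class \<open>LP_plus\<close>\<close>

lemma taylor_eval_fps:
  assumes "fps_conv_radius F = \<infinity>"
  shows "taylor (eval_fps F) = F"
  by (intro fps_expansion_eqI eval_fps_has_fps_expansion) (simp add: assms)

text \<open>The approximants for \<open>LP\<close> are the rescaled Jensen polynomials of
  \<open>F\<close>. Their coefficients are dominated by those of \<open>F\<close>, whose series
  converges everywhere, so Tannery's theorem yields locally uniform convergence.\<close>

lemma P_plus0_limit_in_LP_plus:
  assumes q: "\<And>k. q k \<in> P_plus0" and lim: "\<And>j. (\<lambda>k. coeff (q k) j) \<longlonglongrightarrow> fps_nth F j"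
  shows "F \<in> taylor ` LP_plus \<union> {0}"
proof (cases "F = 0")
  case False
  define c where "c = fps_nth F"
  define m where "m = subdegree F"
  have m: "c m \<noteq> 0" "\<And>j. j < m \<Longrightarrow> c j = 0" using False by (auto simp: c_def m_def)
  note lim = lim[folded c_def]
  have c: "c j \<in> \<real>\<^sub>\<ge>\<^sub>0" for j
    by (rule closed_sequentially[OF closed_nonneg_Reals_complex _ lim]) (use P_plus0_coeff[OF q] in blast)
  define Q where "Q n = jensen n (\<lambda>j. fact j * c j) \<circ>\<^sub>p [:0, of_real (1 / real n):]" for n
  have Q: "Q n \<in> P_plus0" if "n > 0" for n
    unfolding Q_def using jensen_P_plus0[OF P_plus0_stable[OF q] lim c] that by (intro P_plus0_scale) auto
  have coeff_Q: "coeff (Q n) j = of_real (jensen_weight n j) * c j" for n j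
    unfolding Q_def by (rule coeff_jensen_scaled)
  have summ: "summable (\<lambda>j. c j * z ^ j)" for z by (rule P_plus0_limit_summable[OF q lim m])
  have rad: "fps_conv_radius F = \<infinity>"
    unfolding fps_conv_radius_def using summ by (intro conv_radius_inftyI'') (simp add: c_def)
  have ul: "uniform_limit K (\<lambda>n. poly (Q n)) (eval_fps F) sequentially" if "compact K" for K
  proof -
    from that obtain R where R: "\<And>z. z \<in> K \<Longrightarrow> norm z \<le> R" and "R > 0"
      using compact_imp_bounded bounded_pos by metis
    \<comment> \<open>\<open>e n j\<close> bounds the error in the \<open>j\<close>-th term for all
      \<open>z\<close> with \<open>norm z \<le> R\<close>, which makes the estimate uniform on
      \<open>K\<close>.\<close>
    define e where "e n j = (1 - jensen_weight n j) * (norm (c j) * R ^ j)" for n j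
    have e0: "0 \<le> e n j" and e1: "e n j \<le> norm (c j) * R ^ j" for n j
      using jensen_weight_bounds[of n j] \<open>R > 0\<close> by (auto simp: e_def intro!: mult_left_le_one_le)
    have sR: "summable (\<lambda>j. norm (c j) * R ^ j)"
    proof -
      have "norm (of_real R :: complex) < fps_conv_radius F" by (simp add: rad)
      from norm_summable_fps[OF this] show ?thesis using \<open>R > 0\<close> by (simp add: c_def norm_mult norm_power)
    qed
    have se: "summable (e n)" for n
      by (rule summable_comparison_test'[OF sR, of 0]) (use e0 e1 in auto)
    have "(\<lambda>n. \<Sum>j. e n j) \<longlonglongrightarrow> (\<Sum>j. (0::real))"
    proof (rule tannerys_theorem[THEN conjunct2, THEN conjunct2])
      show "(\<lambda>n. e n j) \<longlonglongrightarrow> 0" for j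
      proof -
        have "(\<lambda>n. e n j) \<longlonglongrightarrow> (1 - 1) * (norm (c j) * R ^ j)"
          unfolding e_def by (intro tendsto_intros jensen_weight_tendsto)
        then show ?thesis by simp
      qed
      show "\<forall>\<^sub>F (j, n) in at_top \<times>\<^sub>F sequentially. norm (e n j) \<le> norm (c j) * R ^ j"
        using e0 e1 by (intro always_eventually) auto
    qed (use sR in auto)
    then have e_lim: "(\<lambda>n. \<Sum>j. e n j) \<longlonglongrightarrow> 0" by simp
    have b: "dist (poly (Q n) z) (eval_fps F z) \<le> (\<Sum>j. e n j)" if "z \<in> K" for n z
    proof -
      have "summable (\<lambda>j. fps_nth (fps_of_poly (Q n)) j * z ^ j)" by (intro summable_fps) simp
      then have sQ: "summable (\<lambda>j. coeff (Q n) j * z ^ j)" by simp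
      have nb: "norm (coeff (Q n) j * z ^ j - c j * z ^ j) \<le> e n j" for j
      proof -
        have "coeff (Q n) j * z ^ j - c j * z ^ j = of_real (jensen_weight n j - 1) * (c j * z ^ j)"
          by (simp add: coeff_Q algebra_simps)
        also have "norm \<dots> = (1 - jensen_weight n j) * (norm (c j) * norm z ^ j)"
          using jensen_weight_bounds[of n j] 
          by (simp only: norm_mult norm_power norm_of_real abs_minus_commute[of "jensen_weight n j" 1]
              abs_of_nonneg diff_ge_0_iff_ge)
        also have "\<dots> \<le> e n j"
          unfolding e_def using jensen_weight_bounds[of n j] R[OF that]
          by (intro mult_left_mono power_mono) auto
        finally show ?thesis .
      qed
      have "poly (Q n) z = (\<Sum>j. coeff (Q n) j * z ^ j)"
        unfolding eval_fps_of_poly[symmetric] eval_fps_def by simp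
      then have "dist (poly (Q n) z) (eval_fps F z) = norm (\<Sum>j. coeff (Q n) j * z ^ j - c j * z ^ j)"
        by (simp add: dist_norm eval_fps_def suminf_diff[OF sQ summ] flip: c_def)
      also have "\<dots> \<le> (\<Sum>j. norm (coeff (Q n) j * z ^ j - c j * z ^ j))"
        by (intro summable_norm summable_comparison_test'[OF se[of n], of 0]) (use nb in auto)
      also have "\<dots> \<le> (\<Sum>j. e n j)"
        using nb by (intro suminf_le se summable_comparison_test'[OF se[of n], of 0]) auto
      finally show ?thesis .
    qed
    show ?thesis
    proof (rule uniform_limitI)
      fix d :: real assume "d > 0"
      then have "\<forall>\<^sub>F n in sequentially. (\<Sum>j. e n j) < d" using order_tendstoD(2)[OF e_lim] by blast
      then show "\<forall>\<^sub>F n in sequentially. \<forall>z\<in>K. dist (poly (Q n) z) (eval_fps F z) < d"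
        by (rule eventually_mono) (use b le_less_trans in blast)
    qed
  qed
  \<comment> \<open>The shift makes the index positive and at least \<open>m\<close>. The
    \<open>m\<close>-th coefficient is then nonzero, since \<open>real_rooted\<close> excludes the
    zero polynomial.\<close>
  define p where "p n = map_poly Re (Q (n + Suc m))" for n
  have p: "map_poly of_real (p n) = Q (n + Suc m)" for n
  proof (rule poly_eqI)
    fix j
    have "coeff (Q (n + Suc m)) j \<in> \<real>\<^sub>\<ge>\<^sub>0" by (intro P_plus0_coeff Q) simp
    then show "coeff (map_poly complex_of_real (p n)) j = coeff (Q (n + Suc m)) j"
      by (simp add: p_def coeff_map_poly complex_nonneg_Reals_iff complex_eq_iff)
  qed
  have "real_rooted (p n)" for n
  proof -
    have "coeff (Q (n + Suc m)) m \<noteq> 0" using m jensen_weight_pos[of m "n + Suc m"] by (simp add: coeff_Q)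
    then have ne: "Q (n + Suc m) \<noteq> 0" by auto
    then have "Q (n + Suc m) \<in> P_plus" using Q[of "n + Suc m"] by simp
    moreover have "p n \<noteq> 0" using ne p[of n] by auto
    ultimately show ?thesis using nonpos_Reals_subset_Reals unfolding real_rooted_def p P_plus_def by blast
  qed
  moreover have "uniform_limit K (\<lambda>n. poly (map_poly of_real (p n))) (eval_fps F) sequentially" if "compact K" for K
    unfolding p using filterlim_compose[OF ul[OF that] filterlim_add_const_nat_at_top[of "Suc m"]] .
  moreover have "eval_fps F holomorphic_on UNIV" by (intro holomorphic_on_eval_fps) (simp add: rad)
  ultimately have "eval_fps F \<in> LP" unfolding LP_def by blast
  moreover have "fps_nth (taylor (eval_fps F)) n \<in> \<real>\<^sub>\<ge>\<^sub>0" for n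
    unfolding taylor_eval_fps[OF rad] using c[of n] by (simp only: c_def)
  ultimately have "eval_fps F \<in> LP_plus" unfolding LP_plus_def by blast
  then have "taylor (eval_fps F) \<in> taylor ` LP_plus" by (rule imageI)
  then show ?thesis unfolding taylor_eval_fps[OF rad] by (rule UnI1)
qed simp

text \<open>The real-rooted approximants may have zeros and coefficients of any sign. Locally
  uniform convergence carries over to derivatives at 0, hence to coefficients, and
  \<open>jensen_P_plus0\<close> then replaces the approximants by ones in
  \<open>P_plus0\<close>.\<close>

lemma LP_plus_limit:
  assumes f: "f \<in> LP_plus"
  obtains q where "\<And>k. q k \<in> P_plus0" and "\<And>j. (\<lambda>k. coeff (q k) j) \<longlonglongrightarrow> fps_nth (taylor f) j"
proof -
  define c where "c = fps_nth (taylor f)"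
  obtain p :: "nat \<Rightarrow> real poly" where p: "\<And>n. real_rooted (p n)"
    and ul: "\<And>K. compact K \<Longrightarrow> uniform_limit K (\<lambda>n. poly (map_poly of_real (p n))) f sequentially"
    using f unfolding LP_plus_def LP_def by blast
  have c: "c j \<in> \<real>\<^sub>\<ge>\<^sub>0" for j using f by (auto simp: LP_plus_def c_def)
  define P where "P n = (map_poly of_real (p n) :: complex poly)" for n
  have ul': "uniform_limit (ball 0 1) (\<lambda>n. poly (P n)) f sequentially"
    unfolding P_def using ul[of "cball 0 1"] by (rule uniform_limit_on_subset) auto
  have tay: "fps_nth (taylor (poly (P n))) j = coeff (P n) j" for n j
  proof -
    have "taylor (poly (P n)) = taylor (eval_fps (fps_of_poly (P n)))" by (simp add: eval_fps_of_poly[abs_def])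
    also have "\<dots> = fps_of_poly (P n)" by (rule taylor_eval_fps) simp
    finally show ?thesis by simp
  qed
  have lim: "(\<lambda>n. coeff (P n) j) \<longlonglongrightarrow> c j" for j
  proof -
    have "(\<lambda>n. (deriv ^^ j) (poly (P n)) 0) \<longlonglongrightarrow> (deriv ^^ j) f 0"
      by (rule higher_deriv_complex_uniform_limit[OF ul']) (auto intro!: always_eventually holomorphic_intros)
    then have "(\<lambda>n. (deriv ^^ j) (poly (P n)) 0 / fact j) \<longlonglongrightarrow> (deriv ^^ j) f 0 / fact j"
      by (intro tendsto_intros) auto
    then show ?thesis unfolding tay[symmetric] c_def by (simp add: fps_expansion_def)
  qed
  have st: "rhp_stable (P n \<circ>\<^sub>p [:0, \<i>:])" for n
    using p[of n] by (auto simp: real_rooted_def rhp_stable_def P_def poly_pcompose complex_is_Real_iff)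
  define Q where "Q n = jensen (Suc n) (\<lambda>j. fact j * c j) \<circ>\<^sub>p [:0, of_real (1 / real (Suc n)):]" for n
  have "Q n \<in> P_plus0" for n
    unfolding Q_def using jensen_P_plus0[OF st lim c] by (intro P_plus0_scale) auto
  moreover have "(\<lambda>n. coeff (Q n) j) \<longlonglongrightarrow> c j" for j
    unfolding Q_def using LIMSEQ_Suc[OF coeff_jensen_scaled_tendsto] .
  ultimately show thesis using that unfolding c_def by blast
qed

section \<open>The quadratic form behind \<open>V_op\<close>\<close>

definition quad_form :: "(int \<Rightarrow> complex) \<Rightarrow> complex \<Rightarrow> complex poly \<Rightarrow> complex" where
  "quad_form \<beta> w p = (\<Sum>i\<le>degree p. \<Sum>j\<le>degree p. \<beta> (int i - int j) * coeff p i * coeff p j * w ^ (i + j))"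

definition factor_step :: "complex \<Rightarrow> complex \<Rightarrow> (int \<Rightarrow> complex) \<Rightarrow> int \<Rightarrow> complex" where
  "factor_step r w \<beta> d = (r\<^sup>2 + w\<^sup>2) * \<beta> d + r * w * (\<beta> (d + 1) + \<beta> (d - 1))"

primrec moment :: "nat \<Rightarrow> (int \<Rightarrow> complex) \<Rightarrow> complex" where
  "moment 0 \<beta> = \<beta> 0"
| "moment (Suc m) \<beta> = moment m (\<lambda>d. \<beta> (d + 1) + \<beta> (d - 1))"

lemma moment_linear: "moment m (\<lambda>d. u * \<beta> d + v * \<gamma> d) = u * moment m \<beta> + v * moment m \<gamma>"
proof (induction m arbitrary: \<beta> \<gamma>)
  case (Suc m)
  show ?case
    using Suc[of "\<lambda>d. \<beta> (d + 1) + \<beta> (d - 1)" "\<lambda>d. \<gamma> (d + 1) + \<gamma> (d - 1)"] by (simp add: algebra_simps)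
qed simp

text \<open>One linear factor acts on the sequence of moments alone. This follows by linearity, as
  the moment of order \<open>Suc m\<close> is the moment of order \<open>m\<close> of the shifted
  sum.\<close>

lemma moment_step: "moment m (factor_step r w \<beta>) = (r\<^sup>2 + w\<^sup>2) * moment m \<beta> + r * w * moment (Suc m) \<beta>"
  using moment_linear[of m "r\<^sup>2 + w\<^sup>2" \<beta> "r * w" "\<lambda>d. \<beta> (d + 1) + \<beta> (d - 1)"] by (simp add: factor_step_def[abs_def])

lemma sum_Suc_choose:
  fixes h :: "nat \<Rightarrow> 'a :: comm_semiring_1"
  shows "(\<Sum>i\<le>Suc m. of_nat (Suc m choose i) * h i) = (\<Sum>i\<le>m. of_nat (m choose i) * (h i + h (Suc i)))"
proof -
  have "(\<Sum>i\<le>Suc m. of_nat (Suc m choose i) * h i) =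
      (h 0 + (\<Sum>i\<le>m. of_nat (m choose Suc i) * h (Suc i))) + (\<Sum>i\<le>m. of_nat (m choose i) * h (Suc i))"
    by (subst sum.atMost_Suc_shift) (simp add: distrib_right sum.distrib add_ac)
  also have "h 0 + (\<Sum>i\<le>m. of_nat (m choose Suc i) * h (Suc i)) = (\<Sum>i\<le>Suc m. of_nat (m choose i) * h i)"
    by (subst sum.atMost_Suc_shift) simp
  also have "\<dots> = (\<Sum>i\<le>m. of_nat (m choose i) * h i)" by (simp add: binomial_eq_0)
  finally show ?thesis by (simp add: distrib_left sum.distrib)
qed

text \<open>The moment sums \<open>\<beta>\<close> over the endpoints of all walks of
  \<open>m\<close> steps +1 or -1. The free starting point \<open>s\<close> is what the induction
  needs; Pascal's rule does the rest.\<close>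

lemma moment_shift:
  "moment m (\<lambda>d. \<beta> (d + s)) = (\<Sum>i\<le>m. of_nat (m choose i) * \<beta> (s + 2 * int i - int m))"
proof (induction m arbitrary: s)
  case (Suc m)
  have "moment (Suc m) (\<lambda>d. \<beta> (d + s)) = moment m (\<lambda>d. 1 * \<beta> (d + (s + 1)) + 1 * \<beta> (d + (s - 1)))"
    by (simp add: algebra_simps)
  also have "\<dots> = moment m (\<lambda>d. \<beta> (d + (s + 1))) + moment m (\<lambda>d. \<beta> (d + (s - 1)))"
    by (subst moment_linear) simp
  also have "\<dots> = (\<Sum>i\<le>m. of_nat (m choose i) *
      (\<beta> (s + 2 * int i - int (Suc m)) + \<beta> (s + 2 * int (Suc i) - int (Suc m))))"
    unfolding Suc by (simp add: distrib_left sum.distrib algebra_simps)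
  also have "\<dots> = (\<Sum>i\<le>Suc m. of_nat (Suc m choose i) * \<beta> (s + 2 * int i - int (Suc m)))"
    by (rule sum_Suc_choose[symmetric])
  finally show ?case .
qed simp

lemma moment_eq: "moment m \<beta> = (\<Sum>i\<le>m. of_nat (m choose i) * \<beta> (2 * int i - int m))"
  using moment_shift[of m \<beta> 0] by simp

lemma quad_form_const: "quad_form \<beta> w [:c:] = \<beta> 0 * c * c"
  by (simp add: quad_form_def)

lemma sum_coeff_linear_mult:
  fixes p :: "'a :: comm_semiring_1 poly"
  assumes "degree p \<le> n"
  shows "(\<Sum>i\<le>Suc n. coeff ([:r, 1:] * p) i * g i) = (\<Sum>i\<le>n. coeff p i * (r * g i + g (Suc i)))"
proof -
  have "(\<Sum>i\<le>Suc n. coeff ([:r, 1:] * p) i * g i) =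
      (\<Sum>i\<le>Suc n. r * coeff p i * g i) + (\<Sum>i\<le>Suc n. (if i = 0 then 0 else coeff p (i - 1)) * g i)"
    by (simp only: coeff_linear_mult distrib_right sum.distrib)
  also have "(\<Sum>i\<le>Suc n. r * coeff p i * g i) = (\<Sum>i\<le>n. r * coeff p i * g i)"
    using assms by (simp add: coeff_eq_0)
  also have "(\<Sum>i\<le>Suc n. (if i = 0 then 0 else coeff p (i - 1)) * g i) = (\<Sum>i\<le>n. coeff p i * g (Suc i))"
    by (subst sum.atMost_Suc_shift) simp
  finally show ?thesis by (simp add: sum.distrib[symmetric] algebra_simps)
qed

text \<open>Each coefficient of \<open>(r + z) p\<close> has two terms, so every pair
  \<open>(i, j)\<close> yields four: two with the difference \<open>i - j\<close>, of weights
  \<open>r^2\<close> and \<open>w^2\<close>, and two with it changed by 1, of weight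
  \<open>r w\<close>.\<close>

lemma quad_form_factor:
  assumes "p \<noteq> 0"
  shows "quad_form \<beta> w ([:-a, 1:] * p) = quad_form (factor_step (-a) w \<beta>) w p"
proof -
  define r where "r = - a"
  define n where "n = degree p"
  define P where "P = [:r, 1:] * p"
  note lin = sum_coeff_linear_mult[where p = p and n = n and r = r, folded P_def, OF eq_refl[OF n_def[symmetric]]]
  have "degree P = Suc n" using degree_linear_mult[OF assms, of a] by (simp add: P_def r_def n_def)
  then have "quad_form \<beta> w P = (\<Sum>i\<le>Suc n. coeff P i * (w ^ i * (\<Sum>j\<le>Suc n. coeff P j * (\<beta> (int i - int j) * w ^ j))))"
    unfolding quad_form_def sum_distrib_left by (simp only: power_add mult_ac)
  also have "\<dots> = (\<Sum>i\<le>n. coeff p i *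
      (r * (w ^ i * (\<Sum>j\<le>n. coeff p j * (r * (\<beta> (int i - int j) * w ^ j) + \<beta> (int i - int (Suc j)) * w ^ Suc j))) +
      (w ^ Suc i * (\<Sum>j\<le>n. coeff p j * (r * (\<beta> (int (Suc i) - int j) * w ^ j) + \<beta> (int (Suc i) - int (Suc j)) * w ^ Suc j)))))"
    unfolding lin ..
  also have "\<dots> = (\<Sum>i\<le>n. \<Sum>j\<le>n. factor_step r w \<beta> (int i - int j) * coeff p i * coeff p j * w ^ (i + j))"
    unfolding sum_distrib_left sum.distrib[symmetric]
  proof (intro sum.cong refl)
    fix i j
    have e: "int i - int (Suc j) = int i - int j - 1" "int (Suc i) - int j = int i - int j + 1"
      "int (Suc i) - int (Suc j) = int i - int j" by auto
    show "coeff p i * (r * (w ^ i * (coeff p j * (r * (\<beta> (int i - int j) * w ^ j) + \<beta> (int i - int (Suc j)) * w ^ Suc j))) +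
        w ^ Suc i * (coeff p j * (r * (\<beta> (int (Suc i) - int j) * w ^ j) + \<beta> (int (Suc i) - int (Suc j)) * w ^ Suc j))) =
        factor_step r w \<beta> (int i - int j) * coeff p i * coeff p j * w ^ (i + j)"
      unfolding e factor_step_def by (simp add: power_add power2_eq_square algebra_simps)
  qed
  also have "\<dots> = quad_form (factor_step r w \<beta>) w p" by (simp add: quad_form_def n_def)
  finally show ?thesis by (simp add: P_def r_def)
qed

text \<open>Splitting off all factors leaves a linear combination of the moments up to
  \<open>degree p\<close>.\<close>

lemma quad_form_eq_0:
  assumes "p \<noteq> 0" and "\<And>m. m \<le> degree p \<Longrightarrow> moment m \<beta> = 0"
  shows "quad_form \<beta> w p = 0"
proof -
  have "\<forall>z. poly p z = 0 \<longrightarrow> z \<in> UNIV" by simp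
  with assms(1) show ?thesis using assms(2)
  proof (induction p arbitrary: \<beta> rule: poly_induct_zeros)
    case (const c)
    then show ?case using const.prems[of 0] by (simp add: quad_form_const)
  next
    case (factor a p)
    have "moment m (factor_step (- a) w \<beta>) = 0" if "m \<le> degree p" for m
      using factor.prems[of m] factor.prems[of "Suc m"] that degree_linear_mult[OF factor.hyps(2), of a]
      by (simp add: moment_step del: mult_pCons_left moment.simps)
    then show ?case unfolding quad_form_factor[OF factor.hyps(2)] by (rule factor.IH)
  qed
qed

text \<open>For \<open>r\<close> and \<open>w\<close> non-negative that linear combination has
  non-negative coefficients. At \<open>w = 1\<close> this will fix the sign of
  \<open>V_poly\<close>.\<close>

lemma quad_form_nonneg:
  assumes "p \<in> P_plus" and "\<And>m. moment m \<beta> \<in> \<real>\<^sub>\<ge>\<^sub>0" and w: "w \<in> \<real>\<^sub>\<ge>\<^sub>0"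
  shows "quad_form \<beta> w p \<in> \<real>\<^sub>\<ge>\<^sub>0"
proof -
  have "p \<noteq> 0" "\<forall>z. poly p z = 0 \<longrightarrow> z \<in> \<real>\<^sub>\<le>\<^sub>0" "lead_coeff p \<in> \<real>\<^sub>\<ge>\<^sub>0" using assms(1) by (auto simp: P_plus_def)
  then show ?thesis using assms(2)
  proof (induction p arbitrary: \<beta> rule: poly_induct_zeros)
    case (const c)
    then show ?case using const.prems(2)[of 0] by (simp add: quad_form_const)
  next
    case (factor a p)
    have a: "- a \<in> \<real>\<^sub>\<ge>\<^sub>0" using factor.hyps(1) by simp
    have "lead_coeff ([:-a, 1:] * p) = lead_coeff p" by (subst lead_coeff_mult) simp
    then have lc: "lead_coeff p \<in> \<real>\<^sub>\<ge>\<^sub>0" using factor.prems(1) by metis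
    have "moment m (factor_step (- a) w \<beta>) \<in> \<real>\<^sub>\<ge>\<^sub>0" for m
      unfolding moment_step
      by (intro nonneg_Reals_add_I nonneg_Reals_mult_I nonneg_Reals_pow_I a w factor.prems(2))
    then show ?case unfolding quad_form_factor[OF factor.hyps(2)] by (intro factor.IH lc)
  qed
qed

text \<open>Each factor replaces the Jensen polynomial of the moments by a multiple of its polar
  derivative with pole \<open>x\<close>, so \<open>jensen_polar\<close> keeps it zero-free. A zero
  of \<open>p\<close> at the origin would put \<open>x\<close> at 0, on the boundary.\<close>

lemma quad_form_neq_0:
  assumes "p \<noteq> 0" and "\<forall>z. poly p z = 0 \<longrightarrow> z \<in> \<real>\<^sub>\<le>\<^sub>0 - {0}"
    and "\<And>y. Re y > 0 \<Longrightarrow> poly (jensen (degree p) (\<lambda>m. moment m \<beta>)) y \<noteq> 0" and w: "Re w > 0"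
  shows "quad_form \<beta> w p \<noteq> 0"
  using assms(1-3)
proof (induction p arbitrary: \<beta> rule: poly_induct_zeros)
  case (const c)
  then show ?case using const.prems[of 1] by (simp add: quad_form_const jensen_def poly_monom)
next
  case (factor a p)
  obtain r where r: "a = - of_real r" "r > 0"
    using factor.hyps(1) by (auto elim!: nonpos_Reals_cases intro: that[of "- x" for x])
  define s where "s = (of_real r)\<^sup>2 + w\<^sup>2"
  define x where "x = of_real r * w / s"
  have "w \<noteq> 0" using w by auto
  \<comment> \<open>\<open>v\<close> is \<open>1/x\<close>, written as a sum of two terms with
    positive real part.\<close>
  define v where "v = of_real r / w + w / of_real r"
  have sv: "s = of_real r * w * v" using r \<open>w \<noteq> 0\<close> by (simp add: s_def v_def power2_eq_square field_simps)
  have "Re (of_real r / w) > 0" using r w by (simp add: Re_divide_of_real Re_divide) (smt (verit) divide_pos_pos mult_pos_pos sum_power2_gt_zero_iff zero_less_power2)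
  moreover have "Re (w / of_real r) > 0" using r w by simp
  ultimately have v: "Re v > 0" by (simp add: v_def)
  then have "v \<noteq> 0" by auto
  then have s: "s \<noteq> 0" using sv r \<open>w \<noteq> 0\<close> by simp
  have "x = 1 / v" using sv r \<open>w \<noteq> 0\<close> \<open>v \<noteq> 0\<close> by (simp add: x_def)
  then have x: "Re x > 0" using v \<open>v \<noteq> 0\<close> by (auto simp: Re_divide intro!: divide_pos_pos sum_power2_gt_zero_iff[THEN iffD2])
  have "moment m (factor_step (- a) w \<beta>) = s * (moment m \<beta> + x * moment (Suc m) \<beta>)" for m
    using s unfolding moment_step r s_def[symmetric] by (simp add: x_def field_simps s_def)
  then have "jensen (degree p) (\<lambda>m. moment m (factor_step (- a) w \<beta>)) =
      smult s (jensen (degree p) (\<lambda>m. moment m \<beta> + x * moment (Suc m) \<beta>))"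
    by (intro poly_eqI) (simp add: coeff_jensen)
  moreover have "poly (jensen (degree p) (\<lambda>m. moment m \<beta> + x * moment (Suc m) \<beta>)) y \<noteq> 0" if "Re y > 0" for y
    using factor.prems unfolding degree_linear_mult[OF factor.hyps(2)] by (rule jensen_polar[OF _ x that])
  ultimately have "\<And>y. Re y > 0 \<Longrightarrow> poly (jensen (degree p) (\<lambda>m. moment m (factor_step (- a) w \<beta>))) y \<noteq> 0"
    using s by simp
  then show ?case unfolding quad_form_factor[OF factor.hyps(2)] by (rule factor.IH)
qed

section \<open>\<open>V_op\<close> on polynomials as a quadratic form\<close>

text \<open>This removes zeros at the origin, which \<open>quad_form_neq_0\<close> does not
  admit.\<close>

lemma V_op_X_mult: "V_op \<alpha> (fps_X * \<phi>) = fps_X * V_op \<alpha> \<phi>"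
proof (rule fps_ext)
  fix k
  show "fps_nth (V_op \<alpha> (fps_X * \<phi>)) k = fps_nth (fps_X * V_op \<alpha> \<phi>) k"
  proof (cases k)
    case 0
    then show ?thesis by (simp add: V_op_def)
  next
    case (Suc n)
    have "(\<Sum>j\<le>n. of_real (\<alpha> j) * fps_nth (fps_X * \<phi>) (k - j) * fps_nth (fps_X * \<phi>) (k + 1 + j)) =
        (\<Sum>j\<le>n. of_real (\<alpha> j) * fps_nth \<phi> (n - j) * fps_nth \<phi> (n + 1 + j))"
      by (intro sum.cong) (auto simp: Suc Suc_diff_le)
    then show ?thesis by (simp add: V_op_def Suc)
  qed
qed

lemma V_op_tendsto:
  assumes "\<And>j. (\<lambda>k. coeff (q k) j) \<longlonglongrightarrow> fps_nth \<phi> j"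
  shows "(\<lambda>k. fps_nth (V_op \<alpha> (fps_of_poly (q k))) n) \<longlonglongrightarrow> fps_nth (V_op \<alpha> \<phi>) n"
  unfolding V_op_def by (simp, intro tendsto_intros assms)

definition V_poly :: "(nat \<Rightarrow> real) \<Rightarrow> complex poly \<Rightarrow> complex poly" where
  "V_poly \<alpha> p = (\<Sum>k<degree p. monom (fps_nth (V_op \<alpha> (fps_of_poly p)) k) k)"

lemma fps_of_poly_V_poly: "fps_of_poly (V_poly \<alpha> p) = V_op \<alpha> (fps_of_poly p)"
proof (rule fps_ext)
  fix k
  have "fps_nth (V_op \<alpha> (fps_of_poly p)) k = 0" if "k \<ge> degree p"
    using that by (auto simp: V_op_def coeff_eq_0 intro!: sum.neutral)
  then show "fps_nth (fps_of_poly (V_poly \<alpha> p)) k = fps_nth (V_op \<alpha> (fps_of_poly p)) k"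
    by (auto simp: V_poly_def coeff_sum coeff_monom)
qed

text \<open>Only positive \<open>d\<close> are kept: this counts each pair of coefficients once.\<close>

definition odd_ext :: "(nat \<Rightarrow> real) \<Rightarrow> int \<Rightarrow> complex" where
  "odd_ext \<alpha> d = (if d > 0 \<and> odd d then of_real (\<alpha> (nat d div 2)) else 0)"

lemma odd_ext_odd: "odd_ext \<alpha> (2 * int j + 1) = of_real (\<alpha> j)"
proof -
  have "nat (2 * int j + 1) = 2 * j + 1" by simp
  then show ?thesis by (simp add: odd_ext_def)
qed

text \<open>For \<open>m = 2 l + 1\<close> the binomial coefficient
  \<open>m choose (l + 1 + j)\<close> is \<open>m!\<close> divided by
  \<open>(l + 1 + j)! (l - j)!\<close>, the denominator in the \<open>l\<close>-th coefficient of
  \<open>V_op\<close> at \<open>exp\<close>.\<close>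

lemma moment_odd_ext:
  "moment m (odd_ext \<alpha>) = (if odd m then fact m * fps_nth (V_op \<alpha> (fps_exp 1)) (m div 2) else 0)"
proof (cases "odd m")
  case False
  then have "odd_ext \<alpha> (2 * int i - int m) = 0" for i by (simp add: odd_ext_def)
  then show ?thesis using False by (simp add: moment_eq)
next
  case True
  then obtain l where l: "m = 2 * l + 1" by (elim oddE)
  have "moment m (odd_ext \<alpha>) = (\<Sum>i\<in>{l + 1..m}. of_nat (m choose i) * odd_ext \<alpha> (2 * int i - int m))"
    unfolding moment_eq by (intro sum.mono_neutral_right) (auto simp: odd_ext_def l)
  also have "\<dots> = (\<Sum>j\<le>l. of_nat (m choose (l + 1 + j)) * of_real (\<alpha> j))"
  proof (rule sum.reindex_bij_witness[of _ "\<lambda>j. l + 1 + j" "\<lambda>i. i - (l + 1)"])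
    fix i assume i: "i \<in> {l + 1..m}"
    then have "2 * int i - int m = 2 * int (i - (l + 1)) + 1" by (simp add: l)
    then show "of_nat (m choose (l + 1 + (i - (l + 1)))) * of_real (\<alpha> (i - (l + 1))) =
        of_nat (m choose i) * odd_ext \<alpha> (2 * int i - int m)"
      using i by (simp only: odd_ext_odd) simp
  qed (auto simp: l)
  also have "\<dots> = (\<Sum>j\<le>l. fact m * (of_real (\<alpha> j) / (fact (l - j) * fact (l + 1 + j))))"
  proof (intro sum.cong refl)
    fix j assume "j \<in> {..l}"
    then have "m - (l + 1 + j) = l - j" "l + 1 + j \<le> m" by (auto simp: l)
    then show "complex_of_nat (m choose (l + 1 + j)) * of_real (\<alpha> j) =
        fact m * (of_real (\<alpha> j) / (fact (l - j) * fact (l + 1 + j)))"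
      by (simp add: binomial_fact mult_ac)
  qed
  also have "\<dots> = fact m * fps_nth (V_op \<alpha> (fps_exp 1)) (m div 2)"
    unfolding sum_distrib_left[symmetric] by (simp add: V_op_def l mult_ac del: fact_Suc)
  finally show ?thesis using True by simp
qed

text \<open>The index pairs \<open>(k + 1 + j, k - j)\<close> run through all pairs with positive
  odd difference; the difference is \<open>2 j + 1\<close> and the sum
  \<open>2 k + 1\<close>.\<close>

lemma quad_form_odd_ext: "quad_form (odd_ext \<alpha>) w p = w * poly (V_poly \<alpha> p) (w\<^sup>2)"
proof -
  define n where "n = degree p"
  define a where "a = coeff p"
  have a0: "a i = 0" if "i > n" for i using that by (simp add: a_def n_def coeff_eq_0)
  define T where "T = {(i, j). i \<le> n \<and> j < i \<and> odd (int i - int j)}"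
  define S where "S = {(k, j). j \<le> k \<and> k + 1 + j \<le> n}"
  have "quad_form (odd_ext \<alpha>) w p =
      (\<Sum>(i, j)\<in>{..n} \<times> {..n}. odd_ext \<alpha> (int i - int j) * a i * a j * w ^ (i + j))"
    by (simp add: quad_form_def n_def a_def sum.cartesian_product)
  also have "\<dots> = (\<Sum>(i, j)\<in>T. odd_ext \<alpha> (int i - int j) * a i * a j * w ^ (i + j))"
    by (rule sum.mono_neutral_right) (auto simp: T_def odd_ext_def split: if_splits)
  also have "\<dots> = (\<Sum>(k, j)\<in>S. of_real (\<alpha> j) * a (k - j) * a (k + 1 + j) * w ^ (2 * k + 1))"
  proof (rule sum.reindex_bij_witness[of _ "\<lambda>(k, j). (k + 1 + j, k - j)" "\<lambda>(i, j). ((i + j) div 2, (i - j) div 2)"])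
    fix x assume "x \<in> T"
    then obtain i j where x: "x = (i, j)" and ij: "i \<le> n" "j < i" "odd (int i - int j)" by (auto simp: T_def)
    have "odd (i - j)" using ij by (metis even_of_nat less_imp_le of_nat_diff)
    then obtain l where "i - j = 2 * l + 1" by (elim oddE)
    then have i: "i = j + 2 * l + 1" using ij by simp
    then have k: "(i + j) div 2 = j + l" "(i - j) div 2 = l" by auto
    have e: "int i - int j = 2 * int l + 1" by (simp add: i)
    have ar: "j + l - l = j" "j + l + 1 + l = i" "2 * (j + l) + 1 = i + j" by (auto simp: i)
    show "(case case x of (i, j) \<Rightarrow> ((i + j) div 2, (i - j) div 2) of (k, j) \<Rightarrow> (k + 1 + j, k - j)) = x"
      unfolding x prod.case k by (simp add: i)
    show "(case x of (i, j) \<Rightarrow> ((i + j) div 2, (i - j) div 2)) \<in> S"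
      unfolding x prod.case k using ij by (simp add: S_def i)
    show "(case case x of (i, j) \<Rightarrow> ((i + j) div 2, (i - j) div 2) of
        (k, j) \<Rightarrow> of_real (\<alpha> j) * a (k - j) * a (k + 1 + j) * w ^ (2 * k + 1)) =
        (case x of (i, j) \<Rightarrow> odd_ext \<alpha> (int i - int j) * a i * a j * w ^ (i + j))"
      unfolding x prod.case k e odd_ext_odd ar by (simp only: mult_ac)
  next
    fix y assume "y \<in> S"
    then obtain k j where y: "y = (k, j)" and kj: "j \<le> k" "k + 1 + j \<le> n" by (auto simp: S_def)
    obtain i where k: "k = i + j" using kj by (metis le_add_diff_inverse2)
    show "(case case y of (k, j) \<Rightarrow> (k + 1 + j, k - j) of (i, j) \<Rightarrow> ((i + j) div 2, (i - j) div 2)) = y"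
      by (simp add: y k)
    show "(case y of (k, j) \<Rightarrow> (k + 1 + j, k - j)) \<in> T"
      using kj by (cases "even i"; cases "even j") (auto simp: y k T_def)
  qed
  \<comment> \<open>The pairs added here have \<open>k + 1 + j > n\<close>, where the coefficient
    vanishes.\<close>
  also have "\<dots> = (\<Sum>(k, j)\<in>Sigma {..<n} (\<lambda>k. {..k}). of_real (\<alpha> j) * a (k - j) * a (k + 1 + j) * w ^ (2 * k + 1))"
    by (rule sum.mono_neutral_left) (auto simp: S_def intro!: a0)
  also have "\<dots> = (\<Sum>k<n. \<Sum>j\<le>k. of_real (\<alpha> j) * a (k - j) * a (k + 1 + j) * w ^ (2 * k + 1))"
    by (simp add: sum.Sigma)
  also have "\<dots> = w * poly (V_poly \<alpha> p) (w\<^sup>2)"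
    unfolding V_poly_def poly_sum poly_monom n_def[symmetric] sum_distrib_left
    by (intro sum.cong refl) (simp add: V_op_def a_def sum_distrib_left sum_distrib_right power_mult[symmetric] mult_ac)
  finally show ?thesis .
qed

definition odd_subst :: "complex poly \<Rightarrow> complex poly" where
  "odd_subst q = pCons 0 (q \<circ>\<^sub>p [:0, 0, 1:])"

lemma poly_odd_subst: "poly (odd_subst q) w = w * poly q (w\<^sup>2)"
  by (simp add: odd_subst_def poly_pcompose power2_eq_square)

lemma coeff_pcompose_square: "coeff (q \<circ>\<^sub>p [:0, 0, 1:]) i = (if even i then coeff q (i div 2) else 0)"
  for q :: "'a :: comm_ring_1 poly"
proof (induction q arbitrary: i)
  case (pCons c q)
  have "[:0, 0, 1:] * r = pCons 0 (pCons 0 r)" for r :: "'a poly" by simp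
  then have "pCons c q \<circ>\<^sub>p [:0, 0, 1:] = pCons c (pCons 0 (q \<circ>\<^sub>p [:0, 0, 1:]))"
    by (simp add: pcompose_pCons)
  note split = this
  consider "i = 0" | "i = 1" | k where "i = Suc (Suc k)" by (metis One_nat_def not0_implies_Suc)
  then show ?case unfolding split using pCons.IH by cases simp_all
qed simp

lemma coeff_odd_subst: "coeff (odd_subst q) j = (if odd j then coeff q (j div 2) else 0)"
  by (cases j) (auto simp: odd_subst_def coeff_pcompose_square)

lemma nonpos_Reals_square:
  assumes "Re w > 0"
  shows "w\<^sup>2 \<notin> \<real>\<^sub>\<le>\<^sub>0"
proof
  assume w: "w\<^sup>2 \<in> \<real>\<^sub>\<le>\<^sub>0"
  then have "Im w = 0" using assms by (simp add: complex_nonpos_Reals_iff power2_eq_square)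
  then have "Re w * Re w \<le> 0" using w by (simp add: complex_nonpos_Reals_iff power2_eq_square)
  then show False using mult_pos_pos[OF assms assms] by linarith
qed

lemma rhp_stable_odd_subst:
  assumes "q \<in> P_plus0"
  shows "rhp_stable (odd_subst q)"
proof (cases "q = 0")
  case True
  then show ?thesis by (simp add: odd_subst_def rhp_stable_def)
next
  case False
  then have "poly q z = 0 \<Longrightarrow> z \<in> \<real>\<^sub>\<le>\<^sub>0" for z using assms by (auto simp: P_plus_def)
  then have "poly (odd_subst q) w \<noteq> 0" if "Re w > 0" for w
    using nonpos_Reals_square[OF that] that by (auto simp: poly_odd_subst)
  then show ?thesis by (simp add: rhp_stable_def)
qed

section \<open>From (ii) to (i)\<close>

text \<open>Divided by \<open>m!\<close>, the moments are the coefficients of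
  \<open>w F(w^2)\<close> for \<open>F\<close> the image of \<open>exp\<close>. This is the
  coefficientwise limit of the stable polynomials \<open>odd_subst (q k)\<close>.\<close>

lemma rhp_stable_jensen_moment:
  assumes q: "\<And>k. q k \<in> P_plus0"
    and lim: "\<And>j. (\<lambda>k. coeff (q k) j) \<longlonglongrightarrow> fps_nth (V_op \<alpha> (fps_exp 1)) j"
  shows "rhp_stable (jensen n (\<lambda>m. moment m (odd_ext \<alpha>)))"
proof (rule rhp_stable_limit)
  show "rhp_stable (jensen n (\<lambda>j. fact j * coeff (odd_subst (q k)) j))" for k
    by (intro rhp_stable_jensen rhp_stable_odd_subst q)
  show "degree (jensen n (\<lambda>j. fact j * coeff (odd_subst (q k)) j)) \<le> n" for k
    by (rule degree_jensen)
  show "(\<lambda>k. coeff (jensen n (\<lambda>j. fact j * coeff (odd_subst (q k)) j)) j)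
      \<longlonglongrightarrow> coeff (jensen n (\<lambda>m. moment m (odd_ext \<alpha>))) j" for j
    unfolding coeff_jensen coeff_odd_subst moment_odd_ext
    by (cases "odd j") (auto intro!: tendsto_intros lim)
qed

lemma V_poly_in_P_plus0:
  assumes q: "\<And>k. q k \<in> P_plus0"
    and lim: "\<And>j. (\<lambda>k. coeff (q k) j) \<longlonglongrightarrow> fps_nth (V_op \<alpha> (fps_exp 1)) j"
    and p: "p \<in> P_plus" and p0: "poly p 0 \<noteq> 0"
  shows "V_poly \<alpha> p \<in> P_plus0"
proof (cases "V_poly \<alpha> p = 0")
  case False
  define v where "v = V_poly \<alpha> p"
  have v0: "v \<noteq> 0" using False by (simp add: v_def)
  have pz: "p \<noteq> 0" "\<forall>z. poly p z = 0 \<longrightarrow> z \<in> \<real>\<^sub>\<le>\<^sub>0 - {0}" using p p0 by (auto simp: P_plus_def)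
  have moment: "moment m (odd_ext \<alpha>) \<in> \<real>\<^sub>\<ge>\<^sub>0" for m
  proof -
    have "fps_nth (V_op \<alpha> (fps_exp 1)) j \<in> \<real>\<^sub>\<ge>\<^sub>0" for j
      by (rule closed_sequentially[OF closed_nonneg_Reals_complex _ lim]) (use P_plus0_coeff[OF q] in blast)
    moreover have "(fact m :: complex) \<in> \<real>\<^sub>\<ge>\<^sub>0" by (simp add: complex_nonneg_Reals_iff)
    ultimately show ?thesis by (simp add: moment_odd_ext)
  qed
  define J where "J = jensen (degree p) (\<lambda>m. moment m (odd_ext \<alpha>))"
  \<comment> \<open>A zero \<open>J\<close> would count as stable. It is excluded because vanishing
    moments make the quadratic form, and with it \<open>v\<close>, vanish identically.\<close>
  have "J \<noteq> 0"
  proof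
    assume "J = 0"
    have "moment m (odd_ext \<alpha>) = 0" if "m \<le> degree p" for m
      using arg_cong[OF \<open>J = 0\<close>, of "\<lambda>r. coeff r m"] that by (simp add: J_def coeff_jensen)
    then have "poly (odd_subst v) w = 0" for w
      using quad_form_eq_0[OF pz(1)] by (simp add: poly_odd_subst v_def flip: quad_form_odd_ext)
    then have "odd_subst v = 0" using poly_all_0_iff_0 by blast
    then have "coeff v m = 0" for m using coeff_odd_subst[of v "2 * m + 1"] by simp
    then show False using v0 by (simp add: poly_eq_iff)
  qed
  then have J: "poly J y \<noteq> 0" if "Re y > 0" for y
    using rhp_stable_jensen_moment[OF q lim, of "degree p"] that by (auto simp: rhp_stable_def J_def)
  have zeros: "z \<in> \<real>\<^sub>\<le>\<^sub>0" if z: "poly v z = 0" for z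
  proof (rule ccontr)
    assume neg: "z \<notin> \<real>\<^sub>\<le>\<^sub>0"
    \<comment> \<open>The principal root has non-negative real part, and a purely imaginary root
      would make \<open>z\<close> non-positive.\<close>
    define w where "w = csqrt z"
    have "Re w \<noteq> 0"
    proof
      assume "Re w = 0"
      then have "w\<^sup>2 \<in> \<real>\<^sub>\<le>\<^sub>0" by (simp add: complex_nonpos_Reals_iff power2_eq_square)
      then show False using neg by (simp add: w_def)
    qed
    then have "Re w > 0" using Re_csqrt[of z] by (simp add: w_def less_le)
    then have "quad_form (odd_ext \<alpha>) w p \<noteq> 0" using quad_form_neq_0[OF pz] J unfolding J_def by blast
    then show False using z by (simp add: quad_form_odd_ext w_def v_def)
  qed
  \<comment> \<open>The zeros leave the sign of the leading coefficient open. It is the quotient of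
    \<open>poly v 1\<close> by the value at 1 of the monic multiple \<open>u\<close>, which has
    non-negative coefficients.\<close>
  have one: "poly v 1 \<in> \<real>\<^sub>\<ge>\<^sub>0"
    using quad_form_nonneg[OF p moment nonneg_Reals_one_I] by (simp add: quad_form_odd_ext v_def)
  define u where "u = smult (1 / lead_coeff v) v"
  have "u \<in> P_plus" using v0 zeros by (auto simp: u_def P_plus_def)
  then have "coeff u i \<in> \<real>\<^sub>\<ge>\<^sub>0" for i by (intro P_plus0_coeff) auto
  then have "poly u 1 \<in> \<real>\<^sub>\<ge>\<^sub>0" by (auto simp: poly_altdef complex_nonneg_Reals_iff intro!: sum_nonneg)
  moreover have "poly v 1 \<noteq> 0" using zeros[of 1] by auto
  ultimately have "poly v 1 / poly u 1 \<in> \<real>\<^sub>\<ge>\<^sub>0" using one by simp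
  also have "poly v 1 / poly u 1 = lead_coeff v" using \<open>poly v 1 \<noteq> 0\<close> by (simp add: u_def)
  finally show ?thesis using v0 zeros by (simp add: P_plus_def v_def)
qed simp

lemma V_op_preserves_P_plus0:
  assumes q: "\<And>k. q k \<in> P_plus0"
    and lim: "\<And>j. (\<lambda>k. coeff (q k) j) \<longlonglongrightarrow> fps_nth (V_op \<alpha> (fps_exp 1)) j"
    and "p \<in> P_plus0"
  shows "V_op \<alpha> (fps_of_poly p) \<in> fps_of_poly ` P_plus0"
  using assms(3)
proof (induction p)
  case 0
  then show ?case by (auto simp: V_op_def fps_eq_iff intro!: image_eqI[of _ _ 0])
next
  case (pCons a p)
  show ?case
  proof (cases "a = 0")
    case True
    then have "p \<in> P_plus0" using pCons by (auto simp: P_plus_def)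
    then obtain v where v: "v \<in> P_plus0" "V_op \<alpha> (fps_of_poly p) = fps_of_poly v" using pCons.IH by auto
    have "V_op \<alpha> (fps_of_poly (pCons a p)) = fps_of_poly (pCons 0 v)"
      using True v(2) V_op_X_mult[of \<alpha> "fps_of_poly p"] by (simp add: fps_of_poly_pCons mult.commute)
    moreover have "pCons 0 v \<in> P_plus0" using v(1) by (auto simp: P_plus_def)
    ultimately show ?thesis by blast
  next
    case False
    then have "V_poly \<alpha> (pCons a p) \<in> P_plus0" using pCons.prems by (intro V_poly_in_P_plus0[OF q lim]) auto
    then show ?thesis using fps_of_poly_V_poly by (metis imageI)
  qed
qed

section \<open>The equivalences\<close>

text \<open>The Jensen polynomials of \<open>exp\<close> are \<open>(1 + z)^n\<close>, so the
  approximants are the classical \<open>(1 + z/n)^n\<close> with \<open>n\<close> shifted by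
  one.\<close>

lemma exp_limit:
  obtains E where "\<And>k. E k \<in> P_plus0" and "\<And>j. (\<lambda>k. coeff (E k) j) \<longlonglongrightarrow> fps_nth (fps_exp 1) j"
proof -
  define c :: "nat \<Rightarrow> complex" where "c j = 1 / fact j" for j
  have J: "jensen n (\<lambda>j. fact j * c j) \<in> P_plus0" for n
  proof (rule P_plus0I)
    show "coeff (jensen n (\<lambda>j. fact j * c j)) i \<in> \<real>\<^sub>\<ge>\<^sub>0" for i by (simp add: coeff_jensen c_def)
    have "poly (jensen n (\<lambda>j. fact j * c j)) z = (z + 1) ^ n" for z
      unfolding binomial_ring by (simp add: jensen_def c_def poly_sum poly_monom)
    moreover have "\<i> * z + 1 \<noteq> 0" if "Re z > 0" for z using that by (auto simp: complex_eq_iff)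
    ultimately show "rhp_stable (jensen n (\<lambda>j. fact j * c j) \<circ>\<^sub>p [:0, \<i>:])"
      by (auto simp: rhp_stable_def poly_pcompose mult.commute)
  qed
  define E where "E n = jensen (Suc n) (\<lambda>j. fact j * c j) \<circ>\<^sub>p [:0, of_real (1 / real (Suc n)):]" for n
  have "E n \<in> P_plus0" for n unfolding E_def by (intro P_plus0_scale J) simp
  moreover have "(\<lambda>n. coeff (E n) j) \<longlonglongrightarrow> fps_nth (fps_exp 1) j" for j
    unfolding E_def using LIMSEQ_Suc[OF coeff_jensen_scaled_tendsto[of c j]] by (simp add: c_def)
  ultimately show thesis using that by blast
qed

lemma in_LP_plus_iff_limit:
  "F \<in> taylor ` LP_plus \<union> {0} \<longleftrightarrow>
    (\<exists>q. (\<forall>k. q k \<in> P_plus0) \<and> (\<forall>j. (\<lambda>k. coeff (q k) j) \<longlonglongrightarrow> fps_nth F j))"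
proof
  assume "F \<in> taylor ` LP_plus \<union> {0}"
  then consider f where "f \<in> LP_plus" "F = taylor f" | "F = 0" by blast
  then show "\<exists>q. (\<forall>k. q k \<in> P_plus0) \<and> (\<forall>j. (\<lambda>k. coeff (q k) j) \<longlonglongrightarrow> fps_nth F j)"
  proof cases
    case 1
    then show ?thesis using LP_plus_limit[of f] by metis
  next
    case 2
    then show ?thesis by (intro exI[of _ "\<lambda>k. 0"]) simp
  qed
qed (use P_plus0_limit_in_LP_plus in blast)

theorem theorem5p8:
  fixes \<alpha> :: "nat \<Rightarrow> real"
  shows "(V_op \<alpha> ` fps_of_poly ` P_plus \<subseteq> fps_of_poly ` P_plus \<union> {0}
            \<longleftrightarrow> V_op \<alpha> (fps_exp 1) \<in> taylor ` LP_plus \<union> {0})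
       \<and> (V_op \<alpha> (fps_exp 1) \<in> taylor ` LP_plus \<union> {0}
            \<longleftrightarrow> V_op \<alpha> ` taylor ` LP_plus \<subseteq> taylor ` LP_plus \<union> {0})"
    (is "(?i \<longleftrightarrow> ?ii) \<and> (?ii \<longleftrightarrow> ?iii)")
proof -
  have V0: "V_op \<alpha> 0 = 0" by (simp add: V_op_def fps_eq_iff)
  have im: "fps_of_poly ` P_plus0 = fps_of_poly ` P_plus \<union> {0}" by simp
  \<comment> \<open>Both (ii) and (iii) follow from (i) through this: each coefficient of the image
    is a finite sum of products, hence continuous, and the images of the approximants stay in
    \<open>P_plus0\<close>.\<close>
  have limit: "V_op \<alpha> \<phi> \<in> taylor ` LP_plus \<union> {0}"
    if pres: ?i and q: "\<forall>k. q k \<in> P_plus0" "\<forall>j. (\<lambda>k. coeff (q k) j) \<longlonglongrightarrow> fps_nth \<phi> j" for q \<phi>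
  proof -
    have "V_op \<alpha> (fps_of_poly (q k)) \<in> fps_of_poly ` P_plus0" for k
      using pres q(1)[rule_format, of k] V0 unfolding im by (cases "q k = 0") auto
    then obtain v where v: "\<And>k. v k \<in> P_plus0" "\<And>k. V_op \<alpha> (fps_of_poly (q k)) = fps_of_poly (v k)"
      unfolding image_iff Bex_def by metis
    have "(\<lambda>k. coeff (v k) n) \<longlonglongrightarrow> fps_nth (V_op \<alpha> \<phi>) n" for n
      using V_op_tendsto[of q \<phi> \<alpha> n] q(2) unfolding v(2) by simp
    then show ?thesis using v(1) P_plus0_limit_in_LP_plus by blast
  qed
  have i_ii: ?ii if ?i using exp_limit limit[OF that] by metis
  have ii_i: ?i if ?ii
    using that V_op_preserves_P_plus0 unfolding in_LP_plus_iff_limit im[symmetric] by blast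
  have i_iii: ?iii if ?i
  proof
    fix F assume "F \<in> V_op \<alpha> ` taylor ` LP_plus"
    then obtain f where "f \<in> LP_plus" "F = V_op \<alpha> (taylor f)" by blast
    then show "F \<in> taylor ` LP_plus \<union> {0}" using limit[OF that] LP_plus_limit[of f] by metis
  qed
  have "fps_exp (1::complex) \<in> taylor ` LP_plus \<union> {0}"
    unfolding in_LP_plus_iff_limit using exp_limit by metis
  moreover have "fps_exp (1::complex) \<noteq> 0" by (simp add: fps_eq_iff)
  ultimately have iii_ii: ?ii if ?iii using that by blast
  show ?thesis using i_ii ii_i i_iii iii_ii by blast
qed

end
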